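(* Let $U\subset\mathbb{R}$ be an open interval, let $I\subset U$ be a compact interval, and let $\gamma:U\to\mathbb{R}^n$ be a $C^{n+1}$ embedding satisfying $\det(\gamma'(t),\ldots,\gamma^{(n)}(t))\ne0$ for $t\in I$. Let $T\subset I$ be a compact Ahlfors $s$-regular set, where $0<s\le1$, with $\operatorname{diam}T>0$. Then $\gamma(T)$ is uniformly profile-regular, with $$\rho_{\gamma(T)}(a)=s\max_{1\le i\le n}\frac{a_i}{i},\qquad a\in\mathcal K_n.$$ Its lower and upper prints are $$\underline{\mathrm P}(\gamma(T))=\Bigl\{\alpha\in[0,\infty)^n:\ \sum_{i=1}^n i\alpha_i\le s\Bigr\}$$ and $$\overline{\mathrm P}(\gamma(T))=\{\alpha\in[0,\infty)^n:S_1(\alpha)\le s\}\cup\bigcup_{k=2}^n\Bigl\{\alpha\in[0,\infty)^n:S_k(\alpha)<\frac sk\Bigr\}.$$ In particular, $s=\rho_{\gamma(T)}(1,\ldots,1)$.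
   Context: A compact set $T\subset\mathbb{R}$ with $\operatorname{diam}T>0$ is Ahlfors $s$-regular, $0<s\le1$, if there are a finite Borel measure $\mu$ with support $\operatorname{spt}\mu=T$ and constants $0<c_T\le C_T<\infty$ such that $c_Tr^s\le\mu(T\cap[t-r,t+r])\le C_Tr^s$ for every $t\in T$ and $0<r\le\operatorname{diam}T$. $S_k(\alpha)=\sum_{i=k}^n\alpha_i$. An open box in $\mathbb{R}^n$ is an open rectangular box with positive side lengths and arbitrary orientation; its side lengths in decreasing order are $l_1(B)\ge\cdots\ge l_n(B)>0$. Let $\Delta_n=\{\delta\in(0,1)^n:\delta_1\ge\cdots\ge\delta_n\}$. For non-empty bounded $F\subset\mathbb{R}^n$ and $\delta\in\Delta_n$, $N(F;\delta)$ is the least number of open boxes $B$ needed to cover $F$, subject to $l_i(B)\le\delta_i$ for $1\le i\le n$ for every box in the cover (boxes may have different orientations). For $\alpha\in[0,\infty)^n$ write $\delta^\alpha=\prod_i\delta_i^{\alpha_i}$. The lower and upper box dimension prints are $$\underline{\mathrm P}(F)=\Bigl\{\alpha\in[0,\infty)^n:\liminf_{\delta\in\Delta_n,\,\delta_1\downarrow0}N(F;\delta)\delta^\alpha>0\Bigr\},\quad \overline{\mathrm P}(F)=\Bigl\{\alpha\in[0,\infty)^n:\limsup_{\delta\in\Delta_n,\,\delta_1\downarrow0}N(F;\delta)\delta^\alpha>0\Bigr\},$$ the limits being over all of $\Delta_n$ as $\delta_1\downarrow0$. Let $\mathcal K_n=\{a\in(0,\infty)^n:a_1\le\cdots\le a_n\}$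 and $\mathcal C_n=\{a\in\mathcal K_n:a_1=1\}$. For $a\in\mathcal K_n$, $t>0$ let $e^{-ta}=(e^{-ta_1},\dots,e^{-ta_n})$. The profile of $F$ exists if for every $a\in\mathcal K_n$ the limit $\rho_F(a)=\lim_{t\to\infty}\frac1t\log N(F;e^{-ta})$ exists. $F$ is uniformly profile-regular if its profile exists and there are $C\ge1$ and $t_0>0$ such that $C^{-1}e^{t\rho_F(a)}\le N(F;e^{-ta})\le Ce^{t\rho_F(a)}$ for all $a\in\mathcal C_n$, $t\ge t_0$. *)

theory Defs
  imports "HOL-Analysis.Analysis"
begin

text \<open>Coordinates of a vector are indexed by a finite linearly ordered type \<open>'n\<close>. The position of an
  index in that order, a number in \<open>{1..CARD('n)}\<close>, is written \<open>pos i\<close>; a coordinate \<open>x $ i\<close>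
  thus stands for the \<open>pos i\<close>-th coordinate of \<open>x\<close>, and \<open>x $ first\<close> for \<open>x\<^sub>1\<close>.\<close>

definition pos :: "'n::{finite,linorder} \<Rightarrow> nat" where
  "pos i = card {j. j \<le> i}"

definition first :: "'n::{finite,linorder}" where
  "first = Min UNIV"

definition tail_sum :: "nat \<Rightarrow> real ^ 'n::{finite,linorder} \<Rightarrow> real" where
  "tail_sum k \<alpha> = (\<Sum>i | k \<le> pos i. \<alpha> $ i)"

subsection \<open>Regular curves\<close>

definition iter_deriv :: "nat \<Rightarrow> (real \<Rightarrow> 'a::real_normed_vector) \<Rightarrow> real \<Rightarrow> 'a" where
  "iter_deriv k \<gamma> = ((\<lambda>g t. vector_derivative g (at t)) ^^ k) \<gamma>"

text \<open>Meant for open \<open>U\<close>; the value of \<open>vector_derivative\<close> is meaningful only where the function is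
  differentiable.\<close>

definition C_k_on :: "nat \<Rightarrow> (real \<Rightarrow> 'a::real_normed_vector) \<Rightarrow> real set \<Rightarrow> bool" where
  "C_k_on k \<gamma> U \<longleftrightarrow>
     (\<forall>j<k. \<forall>t\<in>U. iter_deriv j \<gamma> differentiable at t) \<and> continuous_on U (iter_deriv k \<gamma>)"

text \<open>An embedding is an immersion that is a homeomorphism onto its image.\<close>

definition C_k_embedding_on :: "nat \<Rightarrow> (real \<Rightarrow> 'a::real_normed_vector) \<Rightarrow> real set \<Rightarrow> bool" where
  "C_k_embedding_on k \<gamma> U \<longleftrightarrow>
     C_k_on k \<gamma> U \<and> (\<forall>t\<in>U. iter_deriv 1 \<gamma> t \<noteq> 0) \<and>
     embedding_map (top_of_set U) euclidean \<gamma>"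

text \<open>The matrix with columns \<open>\<gamma>'(t), \<dots>, \<gamma>\<^sup>(\<^sup>n\<^sup>)(t)\<close>.\<close>

definition derivative_matrix ::
    "(real \<Rightarrow> real ^ 'n::{finite,linorder}) \<Rightarrow> real \<Rightarrow> real ^ 'n::{finite,linorder} ^ 'n::{finite,linorder}" where
  "derivative_matrix \<gamma> t = (\<chi> i j. iter_deriv (pos j) \<gamma> t $ i)"

subsection \<open>Ahlfors regular sets\<close>

definition measure_support :: "'a::topological_space measure \<Rightarrow> 'a set" where
  "measure_support \<mu> = {x. \<forall>V. open V \<and> x \<in> V \<longrightarrow> emeasure \<mu> V > 0}"

definition ahlfors_regular :: "real \<Rightarrow> real set \<Rightarrow> bool" where
  "ahlfors_regular s T \<longleftrightarrow>
     compact T \<and> diameter T > 0 \<and> 0 < s \<and> s \<le> 1 \<and>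
     (\<exists>\<mu> c C. finite_measure \<mu> \<and> sets \<mu> = sets borel \<and> measure_support \<mu> = T \<and>
        0 < c \<and> c \<le> C \<and>
        (\<forall>t\<in>T. \<forall>r. 0 < r \<and> r \<le> diameter T \<longrightarrow>
           c * r powr s \<le> measure \<mu> (T \<inter> {t - r..t + r}) \<and>
           measure \<mu> (T \<inter> {t - r..t + r}) \<le> C * r powr s))"

subsection \<open>Coverings by boxes\<close>

text \<open>\<open>B\<close> is an open box of arbitrary orientation whose side lengths, in decreasing order, are the
  coordinates of \<open>l\<close>. Since orthogonal transformations include coordinate permutations, every box
  arises from a \<open>box 0 l\<close> with decreasing \<open>l\<close>.\<close>

definition open_box_with_sides :: "real ^ 'n::{finite,linorder} \<Rightarrow> (real ^ 'n::{finite,linorder}) set \<Rightarrow> bool" where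
  "open_box_with_sides l B \<longleftrightarrow>
     (\<forall>i. 0 < l $ i) \<and> (\<forall>i j. i \<le> j \<longrightarrow> l $ j \<le> l $ i) \<and>
     (\<exists>c f. orthogonal_transformation f \<and> B = (\<lambda>x. c + f x) ` box 0 l)"

definition Scales :: "(real ^ 'n::{finite,linorder}) set" where
  "Scales = {\<delta>. (\<forall>i. 0 < \<delta> $ i \<and> \<delta> $ i < 1) \<and> (\<forall>i j. i \<le> j \<longrightarrow> \<delta> $ j \<le> \<delta> $ i)}"

text \<open>Meant for bounded \<open>F\<close>, which always has a finite cover.\<close>

definition covering_number :: "(real ^ 'n::{finite,linorder}) set \<Rightarrow> real ^ 'n::{finite,linorder} \<Rightarrow> nat" where
  "covering_number F \<delta> =
     (LEAST m. \<exists>\<B>. finite \<B> \<and> card \<B> = m \<and> F \<subseteq> \<Union>\<B> \<and>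
        (\<forall>B\<in>\<B>. \<exists>l. open_box_with_sides l B \<and> (\<forall>i. l $ i \<le> \<delta> $ i)))"

subsection \<open>Box dimension prints\<close>

text \<open>The filter of \<open>\<delta>\<^sub>1\<down>0\<close> with \<open>\<delta>\<close> ranging over \<open>Scales\<close>.\<close>

definition scales_to_0 :: "(real ^ 'n::{finite,linorder}) filter" where
  "scales_to_0 = inf (filtercomap (\<lambda>\<delta>. \<delta> $ first) (at_right 0)) (principal Scales)"

definition monomial :: "real ^ 'n::{finite,linorder} \<Rightarrow> real ^ 'n::{finite,linorder} \<Rightarrow> real" where
  "monomial \<delta> \<alpha> = (\<Prod>i\<in>UNIV. \<delta> $ i powr \<alpha> $ i)"

definition lower_print :: "(real ^ 'n::{finite,linorder}) set \<Rightarrow> (real ^ 'n::{finite,linorder}) set" where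
  "lower_print F =
     {\<alpha>. (\<forall>i. 0 \<le> \<alpha> $ i) \<and>
          Liminf scales_to_0 (\<lambda>\<delta>. ereal (real (covering_number F \<delta>) * monomial \<delta> \<alpha>)) > 0}"

definition upper_print :: "(real ^ 'n::{finite,linorder}) set \<Rightarrow> (real ^ 'n::{finite,linorder}) set" where
  "upper_print F =
     {\<alpha>. (\<forall>i. 0 \<le> \<alpha> $ i) \<and>
          Limsup scales_to_0 (\<lambda>\<delta>. ereal (real (covering_number F \<delta>) * monomial \<delta> \<alpha>)) > 0}"

subsection \<open>Profiles\<close>

definition Cone :: "(real ^ 'n::{finite,linorder}) set" where
  "Cone = {a. (\<forall>i. 0 < a $ i) \<and> (\<forall>i j. i \<le> j \<longrightarrow> a $ i \<le> a $ j)}"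

definition Normalized_Cone :: "(real ^ 'n::{finite,linorder}) set" where
  "Normalized_Cone = {a \<in> Cone. a $ first = 1}"

definition exp_scale :: "real \<Rightarrow> real ^ 'n::{finite,linorder} \<Rightarrow> real ^ 'n::{finite,linorder}" where
  "exp_scale t a = (\<chi> i. exp (- t * a $ i))"

definition log_growth :: "(real ^ 'n::{finite,linorder}) set \<Rightarrow> real ^ 'n::{finite,linorder} \<Rightarrow> real \<Rightarrow> real" where
  "log_growth F a t = 1 / t * ln (real (covering_number F (exp_scale t a)))"

definition profile_exists :: "(real ^ 'n::{finite,linorder}) set \<Rightarrow> bool" where
  "profile_exists F \<longleftrightarrow> (\<forall>a\<in>Cone. \<exists>L. (log_growth F a \<longlongrightarrow> L) at_top)"

definition profile :: "(real ^ 'n::{finite,linorder}) set \<Rightarrow> real ^ 'n::{finite,linorder} \<Rightarrow> real" where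
  "profile F a = Lim at_top (log_growth F a)"

definition uniformly_profile_regular :: "(real ^ 'n::{finite,linorder}) set \<Rightarrow> bool" where
  "uniformly_profile_regular F \<longleftrightarrow>
     profile_exists F \<and>
     (\<exists>C t0. 1 \<le> C \<and> 0 < t0 \<and>
        (\<forall>a\<in>Normalized_Cone. \<forall>t\<ge>t0.
           inverse C * exp (t * profile F a) \<le> real (covering_number F (exp_scale t a)) \<and>
           real (covering_number F (exp_scale t a)) \<le> C * exp (t * profile F a)))"

end

theory Submission
  imports Defs
begin

text \<open>Everything follows from one estimate for the covering numbers. For a scale \<open>\<delta>\<close> let \<open>r\<close> be the minimum of
  \<open>\<delta> $ i powr (1 / pos i)\<close>. Then the covering number of \<open>\<gamma> ` T\<close> at \<open>\<delta>\<close> lies between two constant multiples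
  of \<open>r powr (- s)\<close>, uniformly over all scales (\<open>nondegenerate_curve.covering_number_growth\<close>).

  For the upper bound, an arc over a parameter interval of length comparable to \<open>r\<close> lies in a box of sides \<open>\<delta>\<close>
  aligned with the Frenet frame, because the coordinate at position \<open>i\<close> grows like the power \<open>i\<close> of the length
  (\<open>short_arc_in_box\<close>). By Ahlfors regularity \<open>T\<close> is covered by about \<open>r powr (- s)\<close> such intervals.

  For the lower bound, let the minimum be attained at \<open>k\<close>. A box with sides at most \<open>\<delta>\<close> is thin, of width about
  \<open>\<delta> $ k\<close>, in all directions orthogonal to its first \<open>pos k - 1\<close> axes. By a dimension count, near each parameter
  one of these directions \<open>w\<close> sees the curve only through its derivatives of order at most \<open>pos k\<close>, so one of
  these derivatives of \<open>t \<mapsto> w \<bullet> \<gamma> t\<close> is bounded away from zero. A sublevel set estimate, obtained from repeated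
  use of the mean value theorem, shows that the curve is in the box only for parameters in a bounded number of
  intervals of length about \<open>r\<close> (\<open>separated_card_in_box\<close>). These carry mass at most a multiple of \<open>r powr s\<close>,
  so many boxes are needed.

  In logarithmic coordinates \<open>x $ i = - ln (\<delta> $ i)\<close> the estimate says that the covering number is
  \<open>exp (s * max_slope x)\<close> up to a constant, where \<open>max_slope x\<close> is the maximum of \<open>x $ i / pos i\<close>. This gives the
  profile at once. The prints ask whether \<open>s * max_slope x - (\<Sum>i. \<alpha> $ i * x $ i)\<close> stays bounded below as
  \<open>x $ first\<close> tends to infinity, for all \<open>x\<close> in the cone or for some, which is an elementary question about a
  piecewise linear function.\<close>

section \<open>Positions of coordinates\<close>

lemma pos_le_iff: "pos i \<le> pos j \<longleftrightarrow> i \<le> j"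
proof -
  have mono: "pos a \<le> pos b" if "a \<le> b" for a b :: 'a
    unfolding pos_def using that by (intro card_mono) auto
  have "pos a < pos b" if "a < b" for a b :: 'a
    unfolding pos_def using that
    by (intro psubset_card_mono psubsetI) (auto simp: set_eq_iff not_le intro: exI[of _ b])
  with mono show ?thesis
    by (meson linorder_not_le)
qed

lemma pos_eq_iff: "pos i = pos j \<longleftrightarrow> i = j"
  by (simp add: eq_iff pos_le_iff)

lemma pos_ge_1: "1 \<le> pos i"
proof -
  have "{j. j \<le> i} \<noteq> {}" by auto
  then show ?thesis by (simp add: pos_def Suc_le_eq card_gt_0_iff)
qed

lemma pos_le_CARD: "pos (i :: 'n::{finite,linorder}) \<le> CARD('n)"
  unfolding pos_def by (rule card_mono) auto

lemma pos_surj: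
  assumes "1 \<le> k" "k \<le> CARD('n::{finite,linorder})"
  obtains i :: "'n::{finite,linorder}" where "pos i = k"
proof -
  have "inj (pos :: 'n \<Rightarrow> nat)"
    by (simp add: inj_def pos_eq_iff)
  then have "card (range (pos :: 'n \<Rightarrow> nat)) = CARD('n)"
    by (simp add: card_image)
  moreover have "range (pos :: 'n \<Rightarrow> nat) \<subseteq> {1..CARD('n)}"
    using pos_ge_1 pos_le_CARD by (auto simp: Suc_le_eq)
  ultimately have "range (pos :: 'n \<Rightarrow> nat) = {1..CARD('n)}"
    by (intro card_subset_eq) auto
  with assms that show thesis
    by (metis atLeastAtMost_iff rangeE)
qed

lemma first_le: "first \<le> i"
  by (simp add: first_def)

lemma pos_first: "pos (first :: 'n::{finite,linorder}) = 1"
proof -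
  have "{j. j \<le> first} = {first :: 'n}"
    using first_le by (auto intro: order_antisym)
  then show ?thesis by (simp add: pos_def)
qed

section \<open>Separated sets and nets on the line\<close>

definition separated :: "real \<Rightarrow> real set \<Rightarrow> bool" where
  "separated d S \<longleftrightarrow> (\<forall>x\<in>S. \<forall>y\<in>S. x \<noteq> y \<longrightarrow> d \<le> \<bar>x - y\<bar>)"

lemma separated_subset: "separated d S \<Longrightarrow> R \<subseteq> S \<Longrightarrow> separated d R"
  unfolding separated_def by blast

text \<open>A separated subset of maximal cardinality is a net: a point of \<open>E\<close> at distance more than \<open>d\<close> from
  all its elements could be added. The bound on cardinalities provides the maximum, and it passes on to
  the net.\<close>

lemma maximal_separated_net:
  fixes E :: "real set" and B :: real
  assumes "0 < d"
    and bound: "\<And>S. finite S \<Longrightarrow> S \<subseteq> E \<Longrightarrow> separated d S \<Longrightarrow> real (card S) \<le> B"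
  obtains S where "finite S" "S \<subseteq> E" "real (card S) \<le> B" "E \<subseteq> (\<Union>x\<in>S. {x - d..x + d})"
proof -
  define P where "P S \<longleftrightarrow> finite S \<and> S \<subseteq> E \<and> separated d S" for S
  have "P {}" by (simp add: P_def separated_def)
  moreover have "\<forall>S. P S \<longrightarrow> card S < nat \<lfloor>B\<rfloor> + 1"
    using bound by (auto simp: P_def le_nat_floor less_Suc_eq_le)
  ultimately obtain S where S: "P S" and max: "\<And>R. P R \<Longrightarrow> card R \<le> card S"
    using ex_has_greatest_nat[of P "{}" card "nat \<lfloor>B\<rfloor> + 1"] by blast
  have "E \<subseteq> (\<Union>x\<in>S. {x - d..x + d})"
  proof
    fix y assume y: "y \<in> E"
    show "y \<in> (\<Union>x\<in>S. {x - d..x + d})"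
    proof (rule ccontr)
      assume "y \<notin> (\<Union>x\<in>S. {x - d..x + d})"
      then have far: "d < \<bar>x - y\<bar>" if "x \<in> S" for x
        using that by (auto simp: abs_if not_le)
      then have "y \<notin> S" using \<open>0 < d\<close> by force
      moreover have "P (insert y S)"
        using S y far unfolding P_def separated_def
        by (auto simp: abs_minus_commute less_imp_le)
      ultimately show False
        using max[of "insert y S"] S by (simp add: P_def)
    qed
  qed
  with S bound that show thesis by (auto simp: P_def)
qed

section \<open>Ahlfors regular sets\<close>

text \<open>Regularity controls radii up to the diameter of \<open>T\<close> only. Beyond it the interval contains all of
  \<open>T\<close>, so the upper bound persists for every radius, and the lower bound persists for radii up to \<open>1\<close> with
  a smaller constant. In this form the estimates no longer mention the diameter.\<close>

lemma ahlfors_regular_growth: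
  assumes "ahlfors_regular s T"
  obtains \<mu> c C where "finite_measure \<mu>" "sets \<mu> = sets borel" "0 < c" "0 < C" "0 < measure \<mu> T"
    "\<And>t r. t \<in> T \<Longrightarrow> 0 < r \<Longrightarrow> r \<le> 1 \<Longrightarrow> c * r powr s \<le> measure \<mu> (T \<inter> {t - r..t + r})"
    "\<And>t r. t \<in> T \<Longrightarrow> 0 < r \<Longrightarrow> measure \<mu> (T \<inter> {t - r..t + r}) \<le> C * r powr s"
proof -
  define D where "D = diameter T"
  obtain \<mu> c C where fin: "finite_measure \<mu>" and sets: "sets \<mu> = sets borel" and c: "0 < c" "c \<le> C"
    and low: "\<And>t r. t \<in> T \<Longrightarrow> 0 < r \<Longrightarrow> r \<le> D \<Longrightarrow> c * r powr s \<le> measure \<mu> (T \<inter> {t - r..t + r})"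
    and upp: "\<And>t r. t \<in> T \<Longrightarrow> 0 < r \<Longrightarrow> r \<le> D \<Longrightarrow> measure \<mu> (T \<inter> {t - r..t + r}) \<le> C * r powr s"
    and T: "compact T" "0 < D" "0 < s"
    using assms unfolding ahlfors_regular_def D_def by blast
  interpret finite_measure \<mu> by (rule fin)
  have inside: "T \<subseteq> {t - D..t + D}" if "t \<in> T" for t
  proof
    fix u assume "u \<in> T"
    then have "dist t u \<le> D"
      unfolding D_def using diameter_bounded_bound[OF compact_imp_bounded[OF T(1)] that] by blast
    then show "u \<in> {t - D..t + D}" by (auto simp: dist_real_def)
  qed
  have whole: "measure \<mu> (T \<inter> {t - r..t + r}) = measure \<mu> T \<and> measure \<mu> (T \<inter> {t - D..t + D}) = measure \<mu> T"
    if "t \<in> T" "D \<le> r" for t r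
  proof -
    have "T \<subseteq> {t - r..t + r}" using inside[OF that(1)] that(2) by fastforce
    then show ?thesis using inside[OF that(1)] by (simp add: Int_absorb2)
  qed
  obtain t0 where t0: "t0 \<in> T"
    using T(2) unfolding D_def by (metis diameter_empty equals0I less_irrefl)
  have pos: "0 < measure \<mu> T"
    using low[OF t0 T(2)] whole[OF t0, of D] c T(2) by (smt (verit) mult_pos_pos powr_gt_zero)
  let ?c = "min c (c * D powr s)"
  show thesis
  proof (rule that[OF fin sets _ _ pos])
    show "0 < ?c" "0 < C" using c T(2) by auto
    fix t r assume t: "t \<in> T" and r: "0 < (r::real)"
    show "measure \<mu> (T \<inter> {t - r..t + r}) \<le> C * r powr s"
    proof (cases "r \<le> D")
      case False
      then have "measure \<mu> (T \<inter> {t - r..t + r}) \<le> C * D powr s"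
        using whole[OF t, of r] upp[OF t T(2)] by simp
      also have "\<dots> \<le> C * r powr s"
        using False T c by (intro mult_left_mono powr_mono2) auto
      finally show ?thesis .
    qed (use upp t r in auto)
    assume r1: "r \<le> 1"
    show "?c * r powr s \<le> measure \<mu> (T \<inter> {t - r..t + r})"
    proof (cases "r \<le> D")
      case True
      have "?c * r powr s \<le> c * r powr s" by (intro mult_right_mono) auto
      with low[OF t r True] show ?thesis by simp
    next
      case False
      have "r powr s \<le> 1" using r r1 T(3) by (intro powr_le1) auto
      then have "?c * r powr s \<le> (c * D powr s) * 1"
        using c by (intro mult_mono) auto
      with False whole[OF t, of r] low[OF t T(2)] show ?thesis by simp
    qed
  qed
qed

text \<open>The intervals of length \<open>2 d / 3\<close> around the points of a \<open>d\<close>-separated subset are pairwise disjoint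
  and each carries mass comparable to \<open>d powr s\<close>, while the total mass is finite.\<close>

lemma ahlfors_separated_card_le:
  assumes "ahlfors_regular s T"
  obtains A where "0 < A"
    "\<And>d S. 0 < d \<Longrightarrow> d \<le> 1 \<Longrightarrow> finite S \<Longrightarrow> S \<subseteq> T \<Longrightarrow> separated d S \<Longrightarrow> real (card S) \<le> A * d powr (- s)"
proof -
  obtain \<mu> c C where fin: "finite_measure \<mu>" and sets: "sets \<mu> = sets borel" and c: "0 < c"
    and pos: "0 < measure \<mu> T"
    and low: "\<And>t r. t \<in> T \<Longrightarrow> 0 < r \<Longrightarrow> r \<le> 1 \<Longrightarrow> c * r powr s \<le> measure \<mu> (T \<inter> {t - r..t + r})"
    using ahlfors_regular_growth[OF assms] by metis
  have T: "closed T" using assms unfolding ahlfors_regular_def by (simp add: compact_imp_closed)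
  interpret finite_measure \<mu> by (rule fin)
  define A where "A = measure \<mu> T * 3 powr s / c"
  show thesis
  proof (rule that)
    show "0 < A" using pos c by (simp add: A_def)
    fix d S assume d: "0 < d" "d \<le> (1::real)" and S: "finite S" "S \<subseteq> T" "separated d S"
    \<comment> \<open>Any fraction of \<open>d\<close> below one half makes these closed intervals disjoint.\<close>
    define J where "J x = T \<inter> {x - d / 3..x + d / 3}" for x
    have meas: "J x \<in> sets \<mu>" for x
      unfolding J_def sets using T by auto
    have "disjoint_family_on J S"
    proof (unfold disjoint_family_on_def, intro ballI impI)
      fix x y assume "x \<in> S" "y \<in> S" "x \<noteq> y"
      then have "d \<le> \<bar>x - y\<bar>" using S(3) by (simp add: separated_def)
      then show "J x \<inter> J y = {}" using d(1) by (auto simp: J_def)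
    qed
    then have "(\<Sum>x\<in>S. measure \<mu> (J x)) = measure \<mu> (\<Union>x\<in>S. J x)"
      using finite_measure_finite_Union[OF S(1), of J] meas by (auto simp: image_subset_iff)
    also have "\<dots> \<le> measure \<mu> T"
      using T by (intro finite_measure_mono) (auto simp: J_def sets)
    finally have "(\<Sum>x\<in>S. measure \<mu> (J x)) \<le> measure \<mu> T" .
    moreover have "(\<Sum>x\<in>S. c * (d / 3) powr s) \<le> (\<Sum>x\<in>S. measure \<mu> (J x))"
      unfolding J_def using S d by (intro sum_mono low) auto
    ultimately have "real (card S) * (c * (d / 3) powr s) \<le> measure \<mu> T" by simp
    moreover have "(d / 3) powr s = d powr s / 3 powr s"
      using d by (simp add: powr_divide)
    ultimately show "real (card S) \<le> A * d powr (- s)"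
      using c d by (simp add: A_def powr_minus field_simps)
  qed
qed

text \<open>The intervals around the net cover \<open>T\<close>, so their masses add up to at least the mass of \<open>T\<close>, and each
  of them has mass at most a multiple of \<open>d powr s\<close>.\<close>

lemma ahlfors_net_card_ge:
  assumes "ahlfors_regular s T"
  obtains A where "0 < A"
    "\<And>d S. 0 < d \<Longrightarrow> finite S \<Longrightarrow> S \<subseteq> T \<Longrightarrow> T \<subseteq> (\<Union>x\<in>S. {x - d..x + d}) \<Longrightarrow>
      1 \<le> A * (real (card S) * d powr s)"
proof -
  obtain \<mu> C where fin: "finite_measure \<mu>" and sets: "sets \<mu> = sets borel" and C: "0 < C"
    and pos: "0 < measure \<mu> T"
    and upp: "\<And>t r. t \<in> T \<Longrightarrow> 0 < r \<Longrightarrow> measure \<mu> (T \<inter> {t - r..t + r}) \<le> C * r powr s"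
    using ahlfors_regular_growth[OF assms] by metis
  have T: "closed T" using assms unfolding ahlfors_regular_def by (simp add: compact_imp_closed)
  interpret finite_measure \<mu> by (rule fin)
  show thesis
  proof (rule that)
    show "0 < C / measure \<mu> T" using pos C by simp
    fix d S assume d: "0 < d" and S: "finite S" "S \<subseteq> T" and cov: "T \<subseteq> (\<Union>x\<in>S. {x - d..x + d})"
    have meas: "T \<inter> {x - d..x + d} \<in> sets \<mu>" for x
      unfolding sets using T by auto
    have "measure \<mu> T \<le> measure \<mu> (\<Union>x\<in>S. T \<inter> {x - d..x + d})"
      using cov meas S(1) by (intro finite_measure_mono sets.finite_UN) auto
    also have "\<dots> \<le> (\<Sum>x\<in>S. measure \<mu> (T \<inter> {x - d..x + d}))"
      using meas S(1) by (intro finite_measure_subadditive_finite) auto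
    also have "\<dots> \<le> (\<Sum>x\<in>S. C * d powr s)"
      using S d by (intro sum_mono upp) auto
    finally show "1 \<le> C / measure \<mu> T * (real (card S) * d powr s)"
      using pos by (simp add: field_simps)
  qed
qed

section \<open>Consequences of the mean value theorem\<close>

text \<open>Taylor's theorem at \<open>t0\<close> without the factorial: each integration of the bound on the last derivative
  gains a factor \<open>\<bar>t - t0\<bar>\<close>. The functions \<open>g 0, \<dots>, g m\<close> are successive derivatives.\<close>

lemma vanishing_derivatives_bound:
  fixes g :: "nat \<Rightarrow> real \<Rightarrow> real"
  assumes "is_interval J" "t0 \<in> J" "t \<in> J"
    and "\<And>i t. i < m \<Longrightarrow> t \<in> J \<Longrightarrow> (g i has_real_derivative g (Suc i) t) (at t)"
    and "\<And>i. i < m \<Longrightarrow> g i t0 = 0"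
    and "\<And>t. t \<in> J \<Longrightarrow> \<bar>g m t\<bar> \<le> M"
  shows "\<bar>g 0 t\<bar> \<le> M * \<bar>t - t0\<bar> ^ m"
  using assms(3-)
proof (induction m arbitrary: g t)
  case 0
  then show ?case by simp
next
  case (Suc m)
  have sub: "closed_segment t0 t \<subseteq> J"
    using assms(1,2) Suc.prems(1) by (simp add: closed_segment_subset is_interval_convex_1)
  have "0 \<le> M" using Suc.prems(4)[OF assms(2)] by linarith
  have "norm (g 0 t - g 0 t0) \<le> (M * \<bar>t - t0\<bar> ^ m) * norm (t - t0)"
  proof (rule field_differentiable_bound[of "closed_segment t0 t" "g 0" "g 1"])
    fix z assume z: "z \<in> closed_segment t0 t"
    show "(g 0 has_real_derivative g 1 z) (at z within closed_segment t0 t)"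
      using Suc.prems(2)[of 0 z] sub z by (auto intro: has_field_derivative_at_within)
    have "\<bar>g (Suc 0) z\<bar> \<le> M * \<bar>z - t0\<bar> ^ m"
      using Suc.IH[of z "\<lambda>i. g (Suc i)"] Suc.prems(2-4) sub z by auto
    also have "\<dots> \<le> M * \<bar>t - t0\<bar> ^ m"
      using \<open>0 \<le> M\<close> z by (intro mult_left_mono power_mono) (auto simp: closed_segment_eq_real_ivl split: if_splits)
    finally show "norm (g 1 z) \<le> M * \<bar>t - t0\<bar> ^ m" by simp
  qed auto
  then show ?case using Suc.prems(3)[of 0] by (simp add: algebra_simps)
qed

text \<open>Between two consecutive points where \<open>\<bar>g\<bar> \<le> \<epsilon>\<close> at distance at least \<open>d\<close>, the mean value theorem
  gives a point where \<open>\<bar>g'\<bar> \<le> 2 \<epsilon> / d\<close>. Pairing up the points keeps the new ones separated by \<open>d\<close>, so the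
  number of points halves at each differentiation.\<close>

lemma separated_sequence_derivative_bound:
  fixes g :: "nat \<Rightarrow> real \<Rightarrow> real" and p :: "nat \<Rightarrow> real"
  assumes J: "is_interval J" and d: "0 < d"
    and "\<And>i t. i < j \<Longrightarrow> t \<in> J \<Longrightarrow> (g i has_real_derivative g (Suc i) t) (at t)"
    and "\<And>t. t \<in> J \<Longrightarrow> \<kappa> \<le> \<bar>g j t\<bar>"
    and "\<And>i. i < 2 ^ j \<Longrightarrow> p i \<in> J \<and> \<bar>g 0 (p i)\<bar> \<le> \<epsilon>"
    and "\<And>i. Suc i < 2 ^ j \<Longrightarrow> p i + d \<le> p (Suc i)"
  shows "\<kappa> * d ^ j \<le> 2 ^ j * \<epsilon>"
  using assms(3-)
proof (induction j arbitrary: g p \<epsilon>)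
  case 0
  then show ?case using "0"(2)[of "p 0"] "0"(3)[of 0] by fastforce
next
  case (Suc j)
  have "\<exists>\<xi>. p (2 * i) \<le> \<xi> \<and> \<xi> \<le> p (2 * i + 1) \<and> \<xi> \<in> J \<and> \<bar>g 1 \<xi>\<bar> \<le> 2 * \<epsilon> / d" if "i < 2 ^ j" for i
  proof -
    let ?a = "p (2 * i)" and ?b = "p (2 * i + 1)"
    have ab: "?a + d \<le> ?b" "?a \<in> J" "?b \<in> J" "\<bar>g 0 ?a\<bar> \<le> \<epsilon>" "\<bar>g 0 ?b\<bar> \<le> \<epsilon>"
      using that Suc.prems(3)[of "2 * i"] Suc.prems(3)[of "2 * i + 1"] Suc.prems(4)[of "2 * i"] by auto
    have inJ: "x \<in> J" if "?a \<le> x" "x \<le> ?b" for x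
      using that ab J by (meson mem_is_interval_1_I)
    obtain z where z: "?a < z" "z < ?b" "g 0 ?b - g 0 ?a = (?b - ?a) * g 1 z"
      using MVT2[of ?a ?b "g 0" "g 1"] ab(1) d Suc.prems(1)[of 0] inJ by auto
    have "d * \<bar>g 1 z\<bar> \<le> (?b - ?a) * \<bar>g 1 z\<bar>"
      using ab(1) by (intro mult_right_mono) auto
    also have "\<dots> = \<bar>g 0 ?b - g 0 ?a\<bar>" using z ab(1) d by (simp add: abs_mult)
    also have "\<dots> \<le> 2 * \<epsilon>" using ab(4,5) by linarith
    finally have "\<bar>g 1 z\<bar> \<le> 2 * \<epsilon> / d" using d by (simp add: field_simps)
    with z inJ[of z] show ?thesis by (intro exI[of _ z]) auto
  qed
  then obtain \<xi> where \<xi>: "\<And>i. i < 2 ^ j \<Longrightarrow> p (2 * i) \<le> \<xi> i \<and> \<xi> i \<le> p (2 * i + 1) \<and> \<xi> i \<in> J \<and> \<bar>g 1 (\<xi> i)\<bar> \<le> 2 * \<epsilon> / d"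
    by metis
  have "\<kappa> * d ^ j \<le> 2 ^ j * (2 * \<epsilon> / d)"
  proof (rule Suc.IH[of "\<lambda>i. g (Suc i)" \<xi>])
    fix i assume i: "Suc i < 2 ^ j"
    have "p (2 * i + 1) + d \<le> p (2 * Suc i)"
      using Suc.prems(4)[of "2 * i + 1"] i by simp
    with \<xi>[of i] \<xi>[of "Suc i"] i show "\<xi> i + d \<le> \<xi> (Suc i)" by linarith
  qed (use Suc.prems \<xi> in auto)
  then show ?case using d by (simp add: field_simps)
qed

text \<open>The sublevel set of a function whose \<open>j\<close>-th derivative is at least \<open>\<kappa>\<close> in absolute value may fall
  into several pieces, but it is thin: it has few points at mutual distance \<open>d\<close> as soon as \<open>d\<close> exceeds a
  multiple of \<open>(\<epsilon> / \<kappa>) powr (1 / j)\<close>.\<close>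

lemma separated_sublevel_card_less:
  fixes g :: "nat \<Rightarrow> real \<Rightarrow> real"
  assumes "is_interval J" and d: "0 < d"
    and "\<And>i t. i < j \<Longrightarrow> t \<in> J \<Longrightarrow> (g i has_real_derivative g (Suc i) t) (at t)"
    and "\<And>t. t \<in> J \<Longrightarrow> \<kappa> \<le> \<bar>g j t\<bar>"
    and S: "finite S" "S \<subseteq> J" "separated d S" "\<And>t. t \<in> S \<Longrightarrow> \<bar>g 0 t\<bar> \<le> \<epsilon>"
    and large: "2 ^ j * \<epsilon> < \<kappa> * d ^ j"
  shows "card S < 2 ^ j"
proof (rule ccontr)
  assume "\<not> card S < 2 ^ j"
  then have card: "2 ^ j \<le> card S" by simp
  define p where "p i = sorted_list_of_set S ! i" for i
  have mem: "p i \<in> S" if "i < 2 ^ j" for i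
    unfolding p_def using that card nth_mem[of i "sorted_list_of_set S"] S(1) by simp
  have step: "p i + d \<le> p (Suc i)" if "Suc i < 2 ^ j" for i
  proof -
    have "p i < p (Suc i)"
      unfolding p_def using that card S(1)
      by (intro sorted_wrt_nth_less[OF strict_sorted_list_of_set]) auto
    moreover have "d \<le> \<bar>p i - p (Suc i)\<bar>"
      using S(3)[unfolded separated_def, rule_format, OF mem[of i] mem[of "Suc i"]] that calculation
      by auto
    ultimately show ?thesis by linarith
  qed
  have "\<kappa> * d ^ j \<le> 2 ^ j * \<epsilon>"
    using assms(1-4) mem S(2,4) step by (intro separated_sequence_derivative_bound[of J d j g \<kappa> p]) auto
  with large show False by simp
qed

section \<open>Orthonormal frames\<close>

lemma unit_vector_orthogonal_to_few:
  fixes v :: "'i \<Rightarrow> 'a::euclidean_space"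
  assumes "finite K" "card K < DIM('a)"
  obtains u where "norm u = 1" "\<And>k. k \<in> K \<Longrightarrow> u \<bullet> v k = 0"
proof -
  have "dim (v ` K) < DIM('a)"
    using assms dim_le_card'[of "v ` K"] card_image_le[of K v] by simp
  then obtain x where x: "x \<noteq> 0" "\<And>y. y \<in> span (v ` K) \<Longrightarrow> orthogonal x y"
    using orthogonal_to_subspace_exists by blast
  show thesis
  proof (rule that)
    show "norm (x /\<^sub>R norm x) = 1" using x(1) by simp
    show "(x /\<^sub>R norm x) \<bullet> v k = 0" if "k \<in> K" for k
      using x(2)[of "v k"] that by (simp add: span_base orthogonal_def)
  qed
qed

text \<open>Applied to the derivatives of a curve this is a Frenet frame: the \<open>i\<close>-th coordinate of the curve has
  vanishing derivatives of order below \<open>pos i\<close>. The frame is built from its last vector downwards: the vector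
  at \<open>i\<close> has to be orthogonal to \<open>v j\<close> for \<open>j < i\<close> and to the frame vectors already chosen, which is fewer
  vectors than the dimension.\<close>

lemma orthonormal_frame_avoiding_earlier:
  fixes v :: "'n \<Rightarrow> real ^ 'n::{finite,linorder}"
  obtains e :: "'n \<Rightarrow> (real, 'n) vec" where
    "\<And>i j. e i \<bullet> e j = (if i = j then 1 else 0)" "\<And>i j. j < i \<Longrightarrow> e i \<bullet> v j = 0"
proof -
  define P where "P K e \<longleftrightarrow> (\<forall>i\<in>K. \<forall>j\<in>K. e i \<bullet> e j = (if i = j then 1 else 0)) \<and>
    (\<forall>i\<in>K. \<forall>j<i. e i \<bullet> v j = 0)" for K :: "'n set" and e :: "'n \<Rightarrow> (real, 'n) vec"
  have "\<exists>e. P K e" for K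
  proof (induction rule: finite_linorder_min_induct[OF finite[of K]])
    case 1
    then show ?case by (simp add: P_def)
  next
    case (2 b K)
    then obtain e where e: "P K e" by blast
    \<comment> \<open>The new vector has to avoid one vector for every index other than \<open>b\<close>, which leaves a dimension.\<close>
    define w where "w j = (if j < b then v j else e j)" for j
    have "card (UNIV - {b}) < DIM((real, 'n) vec)"
      by (simp add: card_Diff_singleton)
    then obtain u where u: "norm u = 1" "\<And>j. j \<in> UNIV - {b} \<Longrightarrow> u \<bullet> w j = 0"
      using unit_vector_orthogonal_to_few[of "UNIV - {b}" w] by auto
    have "b \<notin> K" using 2(2) by auto
    have "u \<bullet> e j = 0" if "j \<in> K" for j
    proof -
      have "b < j" using 2(2) that by blast
      then have "j \<noteq> b" "\<not> j < b" by auto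
      then show ?thesis using u(2)[of j] by (simp add: w_def)
    qed
    moreover have "u \<bullet> v j = 0" if "j < b" for j
      using u(2)[of j] that by (auto simp: w_def)
    ultimately have "P (insert b K) (e(b := u))"
      using e u(1) \<open>b \<notin> K\<close> unfolding P_def by (auto simp: inner_commute norm_eq_1)
    then show ?case by blast
  qed
  then obtain e where "P UNIV e" by blast
  then show thesis using that[of e] by (auto simp: P_def)
qed

lemma orthogonal_transformation_of_frame:
  fixes e :: "'n \<Rightarrow> real ^ 'n::{finite,linorder}"
  assumes "\<And>i j. e i \<bullet> e j = (if i = j then 1 else 0)"
  defines "f \<equiv> \<lambda>x. \<Sum>i\<in>UNIV. (x $ i) *\<^sub>R e i"
  shows "orthogonal_transformation f" "f (\<chi> i. e i \<bullet> y) = y"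
proof -
  have lin: "linear f"
    by (rule linearI) (simp_all add: f_def algebra_simps sum.distrib scaleR_sum_right)
  have coord: "e j \<bullet> f x = x $ j" for x j
    by (simp add: f_def inner_sum_right assms(1) if_distrib[of "\<lambda>z. _ * z"] cong: if_cong)
  show ot: "orthogonal_transformation f"
    unfolding orthogonal_transformation_def
  proof (intro conjI allI lin)
    fix x y
    have "f x \<bullet> f y = (\<Sum>i\<in>UNIV. x $ i * (e i \<bullet> f y))"
      by (subst f_def) (simp add: inner_sum_left)
    then show "f x \<bullet> f y = x \<bullet> y"
      unfolding coord by (simp add: inner_vec_def)
  qed
  obtain x where "y = f x"
    using orthogonal_transformation_surj[OF ot] by (metis surjD)
  then show "f (\<chi> i. e i \<bullet> y) = y" by (simp add: coord)
qed

section \<open>Box covers of a nondegenerate curve\<close>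

definition box_cover ::
    "(real ^ 'n::{finite,linorder}) set \<Rightarrow> real ^ 'n::{finite,linorder} \<Rightarrow> (real ^ 'n::{finite,linorder}) set set \<Rightarrow> bool" where
  "box_cover F \<delta> \<B> \<longleftrightarrow> finite \<B> \<and> F \<subseteq> \<Union>\<B> \<and>
     (\<forall>B\<in>\<B>. \<exists>l. open_box_with_sides l B \<and> (\<forall>i. l $ i \<le> \<delta> $ i))"

lemma covering_number_le: "box_cover F \<delta> \<B> \<Longrightarrow> covering_number F \<delta> \<le> card \<B>"
  unfolding covering_number_def box_cover_def by (rule Least_le) blast

lemma covering_number_attained:
  assumes "box_cover F \<delta> \<B>"
  obtains \<C> where "box_cover F \<delta> \<C>" "card \<C> = covering_number F \<delta>"
proof -
  let ?P = "\<lambda>m. \<exists>\<B>. finite \<B> \<and> card \<B> = m \<and> F \<subseteq> \<Union>\<B> \<and>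
        (\<forall>B\<in>\<B>. \<exists>l. open_box_with_sides l B \<and> (\<forall>i. l $ i \<le> \<delta> $ i))"
  have "?P (card \<B>)" using assms unfolding box_cover_def by blast
  then have "?P (covering_number F \<delta>)"
    unfolding covering_number_def by (rule LeastI)
  then show thesis using that unfolding box_cover_def by blast
qed

text \<open>The curve is \<open>v 0\<close>, and \<open>v j\<close> is its \<open>j\<close>-th derivative. Linear independence of the first \<open>n\<close>
  derivatives is expressed through their orthogonal complement, since a covering box is tested against
  vectors orthogonal to most of its axes.\<close>

locale nondegenerate_curve =
  fixes v :: "nat \<Rightarrow> real \<Rightarrow> real ^ 'n::{finite,linorder}" and I :: "real set"
  assumes compact_I: "compact I" and interval_I: "is_interval I"
    and deriv: "\<And>j t. j < CARD('n) \<Longrightarrow> t \<in> I \<Longrightarrow> (v j has_vector_derivative v (Suc j) t) (at t)"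
    and cont: "\<And>j. j \<le> CARD('n) \<Longrightarrow> continuous_on I (v j)"
    and nondegenerate: "\<And>t w. t \<in> I \<Longrightarrow> (\<And>i::'n. w \<bullet> v (pos i) t = 0) \<Longrightarrow> w = 0"
begin

text \<open>The successive derivatives of \<open>t \<mapsto> w \<bullet> (v 0 t - c)\<close>; the point \<open>c\<close> enters the function itself
  only.\<close>

definition test_functions :: "(real, 'n) vec \<Rightarrow> (real, 'n) vec \<Rightarrow> nat \<Rightarrow> real \<Rightarrow> real" where
  "test_functions w c j t = w \<bullet> (v j t - (if j = 0 then c else 0))"

lemma test_functions_deriv:
  assumes "j < CARD('n)" "t \<in> I"
  shows "(test_functions w c j has_real_derivative test_functions w c (Suc j) t) (at t)"
proof -
  have "((\<lambda>t. v j t - (if j = 0 then c else 0)) has_vector_derivative v (Suc j) t - 0) (at t)"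
    by (intro has_vector_derivative_diff deriv[OF assms] has_vector_derivative_const)
  from bounded_linear.has_vector_derivative[OF bounded_linear_inner_right this, of w] show ?thesis
    unfolding test_functions_def has_real_derivative_iff_has_vector_derivative by simp
qed

lemma derivatives_bounded:
  obtains M where "0 < M" "\<And>(i::'n) t. t \<in> I \<Longrightarrow> norm (v (pos i) t) \<le> M"
proof -
  have "bounded (\<Union>i\<in>UNIV. v (pos (i::'n)) ` I)"
    using compact_I cont[OF pos_le_CARD]
    by (intro bounded_UN) (auto intro!: compact_imp_bounded compact_continuous_image)
  then obtain M where M: "0 < M" "\<forall>y\<in>(\<Union>i\<in>UNIV. v (pos (i::'n)) ` I). norm y \<le> M"
    unfolding bounded_pos by blast
  show thesis
  proof (rule that[OF M(1)])
    fix i :: 'n and t assume "t \<in> I"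
    then show "norm (v (pos i) t) \<le> M" using M(2) by (intro bspec[OF M(2)] UN_I[of i] imageI) auto
  qed
qed

text \<open>In the Frenet frame at \<open>x\<close> the coordinate with index \<open>i\<close> of \<open>v 0 t - v 0 x\<close> is at most
  \<open>M * h ^ pos i\<close>, since its derivatives of lower order vanish at \<open>x\<close>. So a box aligned with this frame
  and centred at \<open>v 0 x\<close> contains the arc.\<close>

lemma short_arc_in_box:
  assumes M: "\<And>(i::'n) t. t \<in> I \<Longrightarrow> norm (v (pos i) t) \<le> M"
    and x: "x \<in> I" and h: "0 \<le> h"
    and \<delta>: "\<And>i. 0 < \<delta> $ i" "\<And>i j. i \<le> j \<Longrightarrow> \<delta> $ j \<le> \<delta> $ i"
    and small: "\<And>i. 2 * (M * h ^ pos i) < \<delta> $ i"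
  obtains B where "open_box_with_sides \<delta> B" "v 0 ` (I \<inter> {x - h..x + h}) \<subseteq> B"
proof -
  obtain e :: "'n \<Rightarrow> (real, 'n) vec" where e: "\<And>i j. e i \<bullet> e j = (if i = j then 1 else 0)"
    and avoid: "\<And>i j. j < i \<Longrightarrow> e i \<bullet> v (pos j) x = 0"
    using orthonormal_frame_avoiding_earlier[of "\<lambda>j. v (pos j) x"] by metis
  define f where "f = (\<lambda>y::(real, 'n) vec. \<Sum>i\<in>UNIV. (y $ i) *\<^sub>R e i)"
  have f: "orthogonal_transformation f" "\<And>y. f (\<chi> i. e i \<bullet> y) = y"
    unfolding f_def using orthogonal_transformation_of_frame[of e] e by auto
  have lin: "linear f" using f(1) by (simp add: orthogonal_transformation_def)
  define z where "z t = (\<chi> i. e i \<bullet> (v 0 t - v 0 x))" for t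
  have z: "\<bar>z t $ i\<bar> < \<delta> $ i / 2" if t: "t \<in> I \<inter> {x - h..x + h}" for t i
  proof -
    have M0: "0 \<le> M" using M[OF x, of i] norm_ge_zero order_trans by blast
    have "\<bar>test_functions (e i) (v 0 x) 0 t\<bar> \<le> M * \<bar>t - x\<bar> ^ pos i"
    proof (rule vanishing_derivatives_bound[OF interval_I x, where g = "test_functions (e i) (v 0 x)"])
      show "t \<in> I" using t by simp
      fix j assume j: "j < pos i"
      then show "(test_functions (e i) (v 0 x) j has_real_derivative
          test_functions (e i) (v 0 x) (Suc j) u) (at u)" if "u \<in> I" for u
        using that pos_le_CARD[of i] by (intro test_functions_deriv) auto
      show "test_functions (e i) (v 0 x) j x = 0"
      proof (cases "j = 0")
        case False
        then obtain i' :: 'n where "pos i' = j"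
          using pos_surj[of j] j pos_le_CARD[of i] by (metis One_nat_def Suc_leI less_imp_le neq0_conv order_trans)
        moreover have "i' < i" using j calculation pos_le_iff[of i i'] by (simp add: not_le[symmetric])
        ultimately show ?thesis using avoid False by (auto simp: test_functions_def)
      qed (simp add: test_functions_def)
    next
      fix u assume u: "u \<in> I"
      have "\<bar>e i \<bullet> v (pos i) u\<bar> \<le> norm (e i) * norm (v (pos i) u)"
        by (rule Cauchy_Schwarz_ineq2)
      also have "norm (e i) = 1" using e[of i i] by (simp add: norm_eq_1)
      finally show "\<bar>test_functions (e i) (v 0 x) (pos i) u\<bar> \<le> M"
        using M[OF u, of i] pos_ge_1[of i] by (simp add: test_functions_def)
    qed
    also have "\<dots> \<le> M * h ^ pos i"
      using t M0 by (intro mult_left_mono power_mono) auto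
    also have "\<dots> < \<delta> $ i / 2" using small[of i] by simp
    finally show ?thesis by (simp add: z_def test_functions_def)
  qed
  \<comment> \<open>\<open>box 0 \<delta>\<close> has a corner at the origin, hence the shift by half of its diagonal.\<close>
  define B where "B = (\<lambda>y. (v 0 x - f ((1 / 2) *\<^sub>R \<delta>)) + f y) ` box 0 \<delta>"
  show thesis
  proof (rule that)
    show "open_box_with_sides \<delta> B"
      unfolding open_box_with_sides_def B_def using \<delta> f(1) by blast
    show "v 0 ` (I \<inter> {x - h..x + h}) \<subseteq> B"
    proof (rule image_subsetI)
      fix t assume t: "t \<in> I \<inter> {x - h..x + h}"
      have "f ((1 / 2) *\<^sub>R \<delta> + z t) = f ((1 / 2) *\<^sub>R \<delta>) + (v 0 t - v 0 x)"
        using f(2)[of "v 0 t - v 0 x"] by (simp add: linear_add[OF lin] z_def)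
      then have "v 0 t = (v 0 x - f ((1 / 2) *\<^sub>R \<delta>)) + f ((1 / 2) *\<^sub>R \<delta> + z t)" by simp
      moreover have "(1 / 2) *\<^sub>R \<delta> + z t \<in> box 0 \<delta>"
        unfolding mem_box_cart
      proof
        fix i show "(0::(real, 'n) vec) $ i < ((1 / 2) *\<^sub>R \<delta> + z t) $ i \<and> ((1 / 2) *\<^sub>R \<delta> + z t) $ i < \<delta> $ i"
          using z[OF t, of i] by (auto simp: abs_less_iff)
      qed
      ultimately show "v 0 t \<in> B" unfolding B_def by blast
    qed
  qed
qed

text \<open>If \<open>r ^ pos i\<close> is at most \<open>\<delta> $ i\<close> for every \<open>i\<close>, then arcs of length comparable to \<open>r\<close> fit
  into single boxes of sides \<open>\<delta>\<close>, so the boxes can be counted by the points of a net of the parameter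
  set.\<close>

lemma box_cover_of_net:
  assumes E: "E \<subseteq> I"
  obtains c where "0 < c" "c \<le> 1"
    "\<And>S r \<delta>. finite S \<Longrightarrow> S \<subseteq> I \<Longrightarrow> E \<subseteq> (\<Union>x\<in>S. {x - c * r..x + c * r}) \<Longrightarrow> 0 < r \<Longrightarrow>
      \<forall>i. r ^ pos i \<le> \<delta> $ i \<Longrightarrow> \<forall>i j. i \<le> j \<longrightarrow> \<delta> $ j \<le> \<delta> $ i \<Longrightarrow>
      \<exists>\<B>. box_cover (v 0 ` E) \<delta> \<B> \<and> card \<B> \<le> card S"
proof -
  obtain M where M: "0 < M" "\<And>(i::'n) t. t \<in> I \<Longrightarrow> norm (v (pos i) t) \<le> M"
    using derivatives_bounded by blast
  \<comment> \<open>Chosen such that \<open>2 * M * c < 1\<close>; positions are at least \<open>1\<close>, so \<open>c ^ pos i \<le> c\<close>.\<close>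
  define c where "c = 1 / (2 * M + 1)"
  have c: "0 < c" "c \<le> 1" "2 * M * c < 1"
    using M(1) by (auto simp: c_def field_simps)
  show thesis
  proof (rule that[OF c(1,2)])
    fix S r and \<delta> :: "(real, 'n) vec"
    assume S: "finite S" "S \<subseteq> I" "E \<subseteq> (\<Union>x\<in>S. {x - c * r..x + c * r})" and r: "0 < r"
      and "\<forall>i. r ^ pos i \<le> \<delta> $ i" "\<forall>i j. i \<le> j \<longrightarrow> \<delta> $ j \<le> \<delta> $ i"
    then have \<delta>: "\<And>i. r ^ pos i \<le> \<delta> $ i" "\<And>i j. i \<le> j \<Longrightarrow> \<delta> $ j \<le> \<delta> $ i" by auto
    have small: "2 * (M * (c * r) ^ pos i) < \<delta> $ i" for i
    proof -
      have "c ^ pos i \<le> c" using c pos_ge_1[of i] power_decreasing[of 1 "pos i" c] by simp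
      then have "(2 * M) * (c ^ pos i * r ^ pos i) \<le> (2 * M) * (c * r ^ pos i)"
        using M(1) r by (intro mult_left_mono mult_right_mono) auto
      then have "2 * (M * (c * r) ^ pos i) \<le> (2 * M * c) * r ^ pos i"
        by (simp add: power_mult_distrib mult.assoc)
      also have "\<dots> < 1 * r ^ pos i" using c r by (intro mult_strict_right_mono) auto
      finally show ?thesis using \<delta>(1)[of i] by simp
    qed
    have pos: "0 < \<delta> $ i" for i
      using \<delta>(1)[of i] r zero_less_power[of r "pos i"] by linarith
    have "\<exists>B. open_box_with_sides \<delta> B \<and> v 0 ` (I \<inter> {x - c * r..x + c * r}) \<subseteq> B" if "x \<in> S" for x
    proof -
      show ?thesis
      proof (rule short_arc_in_box[of M x "c * r" \<delta>])
        show "x \<in> I" "0 \<le> c * r" using S(2) that c r by auto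
        fix B assume B: "open_box_with_sides \<delta> B" "v 0 ` (I \<inter> {x - c * r..x + c * r}) \<subseteq> B"
        show ?thesis by (intro exI[of _ B] conjI B)
      qed (fact M(2) pos \<delta>(2) small)+
    qed
    then obtain B where B: "\<And>x. x \<in> S \<Longrightarrow> open_box_with_sides \<delta> (B x) \<and> v 0 ` (I \<inter> {x - c * r..x + c * r}) \<subseteq> B x"
      by metis
    have "v 0 ` E \<subseteq> \<Union>(B ` S)"
    proof (rule image_subsetI)
      fix t assume "t \<in> E"
      then obtain x where "x \<in> S" "t \<in> I \<inter> {x - c * r..x + c * r}" using S(3) E by blast
      then show "v 0 t \<in> \<Union>(B ` S)" using B by blast
    qed
    then have "box_cover (v 0 ` E) \<delta> (B ` S)"
      using S(1) B unfolding box_cover_def by blast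
    then show "\<exists>\<B>. box_cover (v 0 ` E) \<delta> \<B> \<and> card \<B> \<le> card S"
      using card_image_le[OF S(1)] by blast
  qed
qed

text \<open>By compactness of \<open>I\<close> and of the unit sphere: the sum of the absolute values over all \<open>i\<close> has a
  positive minimum, and one summand reaches the average.\<close>

lemma uniformly_nondegenerate:
  obtains \<kappa> where "0 < \<kappa>" "\<And>t w. t \<in> I \<Longrightarrow> norm w = 1 \<Longrightarrow> \<exists>i::'n. \<kappa> \<le> \<bar>w \<bullet> v (pos i) t\<bar>"
proof (cases "I = {}")
  case True
  then show thesis using that[of 1] by simp
next
  case False
  define \<Phi> where "\<Phi> p = (\<Sum>i\<in>(UNIV::'n set). \<bar>snd p \<bullet> v (pos i) (fst p)\<bar>)" for p :: "real \<times> (real, 'n) vec"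
  have "continuous_on (I \<times> sphere 0 1) (\<lambda>p. v (pos i) (fst p))" for i :: 'n
    by (rule continuous_on_compose2[OF cont[OF pos_le_CARD]]) (auto intro: continuous_intros)
  then have "continuous_on (I \<times> sphere 0 1) \<Phi>"
    unfolding \<Phi>_def by (intro continuous_intros)
  moreover have "compact (I \<times> sphere (0::(real, 'n) vec) 1)"
    using compact_I by (intro compact_Times) auto
  moreover have "axis first (1::real) \<in> sphere (0::(real, 'n) vec) 1" by simp
  then have "I \<times> sphere (0::(real, 'n) vec) 1 \<noteq> {}" using False by blast
  ultimately obtain q where q: "q \<in> I \<times> sphere 0 1" "\<And>p. p \<in> I \<times> sphere 0 1 \<Longrightarrow> \<Phi> q \<le> \<Phi> p"
    using continuous_attains_inf[of "I \<times> sphere (0::(real, 'n) vec) 1" \<Phi>] by blast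
  have "\<Phi> q \<noteq> 0"
  proof
    assume "\<Phi> q = 0"
    then have "snd q \<bullet> v (pos i) (fst q) = 0" for i :: 'n
      unfolding \<Phi>_def by (simp add: sum_nonneg_eq_0_iff)
    then have "snd q = 0" using nondegenerate[of "fst q" "snd q"] q(1) by (simp add: mem_Times_iff)
    then show False using q(1) by (simp add: mem_Times_iff)
  qed
  moreover have "0 \<le> \<Phi> q" unfolding \<Phi>_def by (intro sum_nonneg) simp
  ultimately have pos: "0 < \<Phi> q" by simp
  show thesis
  proof (rule that[of "\<Phi> q / CARD('n)"])
    show "0 < \<Phi> q / CARD('n)" using pos by simp
    fix t and w :: "(real, 'n) vec" assume "t \<in> I" "norm w = 1"
    then have le: "\<Phi> q \<le> \<Phi> (t, w)" using q(2)[of "(t, w)"] by simp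
    show "\<exists>i::'n. \<Phi> q / CARD('n) \<le> \<bar>w \<bullet> v (pos i) t\<bar>"
    proof (rule ccontr)
      assume "\<nexists>i::'n. \<Phi> q / CARD('n) \<le> \<bar>w \<bullet> v (pos i) t\<bar>"
      then have "(\<Sum>i\<in>(UNIV::'n set). \<bar>w \<bullet> v (pos i) t\<bar>) < (\<Sum>i\<in>(UNIV::'n set). \<Phi> q / CARD('n))"
        by (intro sum_strict_mono) (auto simp: not_le)
      then have "\<Phi> (t, w) < \<Phi> q" by (simp add: \<Phi>_def)
      with le show False by simp
    qed
  qed
qed

lemma derivatives_uniformly_continuous:
  assumes "0 < \<epsilon>"
  obtains \<eta> where "0 < \<eta>"
    "\<And>(i::'n) t u. t \<in> I \<Longrightarrow> u \<in> I \<Longrightarrow> \<bar>t - u\<bar> \<le> \<eta> \<Longrightarrow> norm (v (pos i) t - v (pos i) u) \<le> \<epsilon>"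
proof -
  have "\<exists>\<eta>>0. \<forall>t\<in>I. \<forall>u\<in>I. dist u t < \<eta> \<longrightarrow> dist (v (pos i) u) (v (pos i) t) < \<epsilon>" for i :: 'n
  proof -
    have "uniformly_continuous_on I (v (pos i))"
      by (rule compact_uniformly_continuous[OF cont[OF pos_le_CARD] compact_I])
    then show ?thesis
      unfolding uniformly_continuous_on_def using assms by simp
  qed
  then obtain \<eta> where \<eta>: "\<And>i::'n. 0 < \<eta> i"
    "\<And>(i::'n) t u. t \<in> I \<Longrightarrow> u \<in> I \<Longrightarrow> dist u t < \<eta> i \<Longrightarrow> dist (v (pos i) u) (v (pos i) t) < \<epsilon>"
    by metis
  define h where "h = Min (range \<eta>)"
  have h: "0 < h" "h \<le> \<eta> i" for i
    unfolding h_def using \<eta>(1) by (auto intro: Min_le)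
  show thesis
  proof (rule that[of "h / 2"])
    fix i :: 'n and t u assume *: "t \<in> I" "u \<in> I" "\<bar>t - u\<bar> \<le> h / 2"
    then have "dist t u < \<eta> i" using h(1) h(2)[of i] by (auto simp: dist_real_def)
    then show "norm (v (pos i) t - v (pos i) u) \<le> \<epsilon>"
      using \<eta>(2)[of u t i] * by (simp add: dist_norm)
  qed (use h in simp)
qed

text \<open>The vectors \<open>a i\<close> are the axes of the box. In a direction orthogonal to all axes before \<open>k\<close> only the
  sides from \<open>k\<close> on count, and these are at most \<open>l $ k\<close>.\<close>

lemma open_box_width_le:
  assumes box: "open_box_with_sides l B"
  obtains a :: "'n \<Rightarrow> (real, 'n) vec" and b :: "(real, 'n) vec" where
    "\<And>w k y. norm w = 1 \<Longrightarrow> \<forall>i<k. w \<bullet> a i = 0 \<Longrightarrow> y \<in> B \<Longrightarrow>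
      \<bar>w \<bullet> (y - b)\<bar> \<le> CARD('n) * l $ k"
proof -
  obtain b f where l: "\<And>i. 0 < l $ i" "\<And>i j. i \<le> j \<Longrightarrow> l $ j \<le> l $ i"
    and f: "orthogonal_transformation f" and B: "B = (\<lambda>x. b + f x) ` box 0 l"
    using box unfolding open_box_with_sides_def by blast
  have lin: "linear f" using f by (simp add: orthogonal_transformation_def)
  show thesis
  proof (rule that[of "\<lambda>i. f (axis i 1)" b])
    fix w y :: "(real, 'n) vec" and k
    assume w: "norm w = 1" "\<forall>i<k. w \<bullet> f (axis i 1) = 0" and "y \<in> B"
    then obtain x where x: "y = b + f x" "x \<in> box 0 l" using B by blast
    have "w \<bullet> (y - b) = w \<bullet> f (\<Sum>i\<in>UNIV. x $ i *s axis i 1)"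
      using x(1) by (simp add: basis_expansion)
    also have "\<dots> = (\<Sum>i\<in>UNIV. x $ i * (w \<bullet> f (axis i 1)))"
      by (simp add: linear_sum[OF lin] linear_scale[OF lin] scalar_mult_eq_scaleR inner_sum_right)
    finally have "\<bar>w \<bullet> (y - b)\<bar> \<le> (\<Sum>i\<in>(UNIV::'n set). \<bar>x $ i * (w \<bullet> f (axis i 1))\<bar>)" by simp
    also have "\<dots> \<le> (\<Sum>i\<in>(UNIV::'n set). l $ k)"
    proof (rule sum_mono)
      fix i
      show "\<bar>x $ i * (w \<bullet> f (axis i 1))\<bar> \<le> l $ k"
      proof (cases "i < k")
        case True
        then show ?thesis using w(2) l(1)[of k] by simp
      next
        case False
        have "\<bar>w \<bullet> f (axis i 1)\<bar> \<le> norm w * norm (f (axis i 1))" by (rule Cauchy_Schwarz_ineq2)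
        also have "\<dots> = 1" using w(1) f by (simp add: orthogonal_transformation)
        finally have "\<bar>x $ i\<bar> * \<bar>w \<bullet> f (axis i 1)\<bar> \<le> \<bar>x $ i\<bar> * 1" by (intro mult_left_mono) auto
        also have "\<dots> \<le> l $ i" using x(2) by (auto simp: mem_box_cart abs_le_iff less_imp_le)
        also have "\<dots> \<le> l $ k" using l(2) False by simp
        finally show ?thesis by (simp add: abs_mult)
      qed
    qed
    finally show "\<bar>w \<bullet> (y - b)\<bar> \<le> CARD('n) * l $ k" by simp
  qed
qed

text \<open>The curve meets a box only during a bounded number of time intervals of length comparable to \<open>r\<close>.
  Near a time \<open>p\<close> there is a unit vector \<open>w\<close> that is orthogonal to the axes of the box before \<open>k\<close> and to the
  derivatives of the curve at \<open>p\<close> of order above \<open>pos k\<close>, as these are \<open>CARD('n) - 1\<close> vectors. The box has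
  width of order \<open>l $ k\<close> in direction \<open>w\<close>, whereas by nondegeneracy \<open>t \<mapsto> w \<bullet> v 0 t\<close> has a derivative of some
  order at most \<open>pos k\<close> that is bounded below near \<open>p\<close>. If \<open>j\<close> is this order, then
  \<open>l $ k \<le> r ^ pos k \<le> r ^ j\<close>, so the sublevel bound applies to points separated by a multiple of \<open>r\<close>.\<close>

lemma separated_card_in_box:
  obtains K m :: real where "1 \<le> K" "0 \<le> m"
    "\<And>l B r k S. open_box_with_sides l B \<Longrightarrow> 0 < r \<Longrightarrow> r \<le> 1 \<Longrightarrow> l $ k \<le> r ^ pos k \<Longrightarrow>
      finite S \<Longrightarrow> S \<subseteq> I \<Longrightarrow> v 0 ` S \<subseteq> B \<Longrightarrow> separated (K * r) S \<Longrightarrow> real (card S) \<le> m"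
proof -
  obtain \<kappa> where \<kappa>: "0 < \<kappa>" "\<And>t w. t \<in> I \<Longrightarrow> norm w = 1 \<Longrightarrow> \<exists>i::'n. \<kappa> \<le> \<bar>w \<bullet> v (pos i) t\<bar>"
    using uniformly_nondegenerate by blast
  obtain \<eta> where \<eta>: "0 < \<eta>"
    "\<And>(i::'n) t u. t \<in> I \<Longrightarrow> u \<in> I \<Longrightarrow> \<bar>t - u\<bar> \<le> \<eta> \<Longrightarrow> norm (v (pos i) t - v (pos i) u) \<le> \<kappa> / 2"
    using derivatives_uniformly_continuous[OF half_gt_zero[OF \<kappa>(1)]] by blast
  obtain P where P: "finite P" "P \<subseteq> I" "I \<subseteq> (\<Union>p\<in>P. ball p \<eta>)"
    using seq_compact_imp_totally_bounded[of I] compact_I \<eta>(1)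
    by (metis compact_eq_seq_compact_metric)
  define n where "n = real CARD('n)"
  have n: "0 < n" by (simp add: n_def)
  \<comment> \<open>Large enough for the hypothesis \<open>2 ^ j * \<epsilon> < \<kappa> * d ^ j\<close> of the sublevel bound with \<open>d = K * r\<close>,
    \<open>\<epsilon> = n * l $ k\<close> and \<open>\<kappa> / 2\<close> in place of \<open>\<kappa>\<close>, for every order \<open>j\<close> from \<open>1\<close> to \<open>CARD('n)\<close>.\<close>
  define K where "K = 1 + 2 * (2 ^ CARD('n) * n) / \<kappa>"
  have K: "1 \<le> K" "2 ^ CARD('n) * n < \<kappa> / 2 * K"
    using \<kappa>(1) n by (auto simp: K_def field_simps)
  have piece: "card (S \<inter> {p - \<eta>..p + \<eta>}) < 2 ^ CARD('n)"
    if box: "open_box_with_sides l B" and r: "0 < r" "r \<le> 1" and lk: "l $ k \<le> r ^ pos k"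
      and S: "finite S" "S \<subseteq> I" "v 0 ` S \<subseteq> B" "separated (K * r) S" and p: "p \<in> I" for l B r k S p
  proof -
    obtain a :: "'n \<Rightarrow> (real, 'n) vec" and b where width: "\<And>w k y. norm w = 1 \<Longrightarrow>
      \<forall>i<k. w \<bullet> a i = 0 \<Longrightarrow> y \<in> B \<Longrightarrow> \<bar>w \<bullet> (y - b)\<bar> \<le> CARD('n) * l $ k"
      using open_box_width_le[OF box] by blast
    define q where "q i = (if i < k then a i else v (pos i) p)" for i
    obtain w where w: "norm w = 1" "\<And>i. i \<in> UNIV - {k} \<Longrightarrow> w \<bullet> q i = 0"
      using unit_vector_orthogonal_to_few[of "UNIV - {k}" q] by (auto simp: card_Diff_singleton)
    obtain i :: 'n where i: "\<kappa> \<le> \<bar>w \<bullet> v (pos i) p\<bar>" using \<kappa>(2)[OF p w(1)] by blast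
    have "i \<le> k"
    proof (rule ccontr)
      assume "\<not> i \<le> k"
      then have "i \<noteq> k" "\<not> i < k" by auto
      then have "w \<bullet> v (pos i) p = 0" using w(2)[of i] by (auto simp: q_def)
      with i \<kappa>(1) show False by simp
    qed
    define J where "J = I \<inter> {p - \<eta>..p + \<eta>}"
    have J: "is_interval J" unfolding J_def by (intro is_interval_Int interval_I is_interval_cc)
    have pi: "1 \<le> pos i" "pos i \<le> CARD('n)" "pos i \<le> pos k"
      using pos_ge_1 pos_le_CARD \<open>i \<le> k\<close> by (auto simp: pos_le_iff)
    have "card (S \<inter> {p - \<eta>..p + \<eta>}) < 2 ^ pos i"
    proof (rule separated_sublevel_card_less[OF J, of "K * r" "pos i" "test_functions w b" "\<kappa> / 2" _ "n * l $ k"])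
      show "0 < K * r" using K r by simp
      show "(test_functions w b j has_real_derivative test_functions w b (Suc j) t) (at t)"
        if "j < pos i" "t \<in> J" for j t
        using that pi by (intro test_functions_deriv) (auto simp: J_def)
      show "finite (S \<inter> {p - \<eta>..p + \<eta>})" "S \<inter> {p - \<eta>..p + \<eta>} \<subseteq> J"
        using S by (auto simp: J_def)
      show "separated (K * r) (S \<inter> {p - \<eta>..p + \<eta>})"
        using S(4) by (rule separated_subset) simp
      show "\<bar>test_functions w b 0 t\<bar> \<le> n * l $ k" if "t \<in> S \<inter> {p - \<eta>..p + \<eta>}" for t
      proof -
        have "w \<bullet> a i = 0" if "i < k" for i
          using w(2)[of i] that by (auto simp: q_def)
        then show ?thesis
          unfolding n_def test_functions_def using width[of w k "v 0 t"] w(1) S(3) that by auto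
      qed
      show "\<kappa> / 2 \<le> \<bar>test_functions w b (pos i) t\<bar>" if "t \<in> J" for t
      proof -
        have "\<bar>w \<bullet> (v (pos i) t - v (pos i) p)\<bar> \<le> norm w * norm (v (pos i) t - v (pos i) p)"
          by (rule Cauchy_Schwarz_ineq2)
        also have "\<dots> \<le> \<kappa> / 2" using \<eta>(2)[of t p i] that p w(1) by (auto simp: J_def abs_le_iff)
        finally have "\<bar>w \<bullet> v (pos i) t - w \<bullet> v (pos i) p\<bar> \<le> \<kappa> / 2"
          by (simp add: inner_diff_right)
        with i have "\<kappa> / 2 \<le> \<bar>w \<bullet> v (pos i) t\<bar>" by linarith
        then show ?thesis using pi(1) by (simp add: test_functions_def)
      qed
      have "2 ^ pos i * (n * l $ k) \<le> 2 ^ CARD('n) * (n * r ^ pos k)"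
        using pi n lk box by (intro mult_mono) (auto simp: open_box_with_sides_def less_imp_le)
      also have "\<dots> < (\<kappa> / 2 * K) * r ^ pos k"
        using mult_strict_right_mono[OF K(2), of "r ^ pos k"] r by (simp add: mult.assoc)
      also have "\<dots> \<le> (\<kappa> / 2 * K ^ pos i) * r ^ pos i"
        using \<kappa>(1) K(1) r pi power_increasing[of 1 "pos i" K]
        by (intro mult_mono power_decreasing) auto
      finally show "2 ^ pos i * (n * l $ k) < \<kappa> / 2 * (K * r) ^ pos i"
        by (simp add: power_mult_distrib mult.assoc)
    qed
    also have "(2::nat) ^ pos i \<le> 2 ^ CARD('n)" using pi(2) by simp
    finally show ?thesis .
  qed
  show thesis
  proof (rule that[OF K(1)])
    show "0 \<le> real (card P * 2 ^ CARD('n))" by simp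
    fix l :: "(real, 'n) vec" and B r k S
    assume *: "open_box_with_sides l B" "0 < r" "r \<le> 1" "l $ k \<le> r ^ pos k" "finite S" "S \<subseteq> I"
      "v 0 ` S \<subseteq> B" "separated (K * r) S"
    have "S \<subseteq> (\<Union>p\<in>P. S \<inter> {p - \<eta>..p + \<eta>})"
    proof
      fix t assume t: "t \<in> S"
      then obtain p where "p \<in> P" "t \<in> ball p \<eta>" using *(6) P(3) by blast
      then show "t \<in> (\<Union>p\<in>P. S \<inter> {p - \<eta>..p + \<eta>})"
        using t by (auto simp: dist_real_def intro!: bexI[of _ p])
    qed
    then have "card S \<le> card (\<Union>p\<in>P. S \<inter> {p - \<eta>..p + \<eta>})"
      using P(1) *(5) by (intro card_mono) auto
    also have "\<dots> \<le> (\<Sum>p\<in>P. card (S \<inter> {p - \<eta>..p + \<eta>}))" using P(1) by (rule card_UN_le)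
    also have "\<dots> \<le> (\<Sum>p\<in>P. 2 ^ CARD('n))"
      using piece[OF *] P(2) by (intro sum_mono less_imp_le) auto
    finally have "card S \<le> card P * 2 ^ CARD('n)" by simp
    then show "real (card S) \<le> real (card P * 2 ^ CARD('n))" by (rule of_nat_mono)
  qed
qed

text \<open>Every box of the cover accounts for at most \<open>m\<close> intervals of radius \<open>K * r\<close> in the parameter set,
  while covering \<open>T\<close> takes at least a multiple of \<open>r powr (- s)\<close> such intervals.\<close>

lemma box_cover_card_ge:
  assumes T: "ahlfors_regular s T" "T \<subseteq> I"
  obtains A where "\<And>r \<delta> k \<B>. 0 < r \<Longrightarrow> r \<le> 1 \<Longrightarrow> \<delta> $ k \<le> r ^ pos k \<Longrightarrow> box_cover (v 0 ` T) \<delta> \<B> \<Longrightarrow>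
    r powr (- s) \<le> A * real (card \<B>)"
proof -
  obtain K m where K: "1 \<le> K" and m: "0 \<le> m" and
    sep: "\<And>l B r k S. open_box_with_sides l B \<Longrightarrow> 0 < r \<Longrightarrow> r \<le> 1 \<Longrightarrow> l $ k \<le> r ^ pos k \<Longrightarrow>
      finite S \<Longrightarrow> S \<subseteq> I \<Longrightarrow> v 0 ` S \<subseteq> B \<Longrightarrow> separated (K * r) S \<Longrightarrow> real (card S) \<le> m"
    using separated_card_in_box by blast
  obtain A where A: "0 < A"
    "\<And>d S. 0 < d \<Longrightarrow> finite S \<Longrightarrow> S \<subseteq> T \<Longrightarrow> T \<subseteq> (\<Union>x\<in>S. {x - d..x + d}) \<Longrightarrow>
      1 \<le> A * (real (card S) * d powr s)"
    using ahlfors_net_card_ge[OF T(1)] by blast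
  show thesis
  proof (rule that)
    fix r k \<B> and \<delta> :: "(real, 'n) vec"
    assume r: "0 < r" "r \<le> 1" and \<delta>: "\<delta> $ k \<le> r ^ pos k" and cover: "box_cover (v 0 ` T) \<delta> \<B>"
    have Kr: "0 < K * r" using K r by simp
    define E where "E B = {t \<in> T. v 0 t \<in> B}" for B
    have "\<exists>S. finite S \<and> S \<subseteq> E B \<and> real (card S) \<le> m \<and> E B \<subseteq> (\<Union>x\<in>S. {x - K * r..x + K * r})"
      if "B \<in> \<B>" for B
    proof -
      have "\<exists>l. open_box_with_sides l B \<and> (\<forall>i. l $ i \<le> \<delta> $ i)"
        using cover that by (simp add: box_cover_def)
      then obtain l where l: "open_box_with_sides l B" "\<And>i. l $ i \<le> \<delta> $ i"
        by metis
      have lk: "l $ k \<le> r ^ pos k" using l(2)[of k] \<delta> by linarith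
      have "real (card S) \<le> m" if "finite S" "S \<subseteq> E B" "separated (K * r) S" for S
      proof (rule sep[OF l(1) r lk that(1) _ _ that(3)])
        show "S \<subseteq> I" using that(2) T(2) by (auto simp: E_def)
        show "v 0 ` S \<subseteq> B" using that(2) by (auto simp: E_def)
      qed
      then show ?thesis by (rule maximal_separated_net[OF Kr, of "E B" m]) blast+
    qed
    then obtain net where net: "\<And>B. B \<in> \<B> \<Longrightarrow> finite (net B) \<and> net B \<subseteq> E B \<and> real (card (net B)) \<le> m \<and>
        E B \<subseteq> (\<Union>x\<in>net B. {x - K * r..x + K * r})"
      by metis
    define S where "S = (\<Union>B\<in>\<B>. net B)"
    have fin: "finite \<B>" using cover by (simp add: box_cover_def)
    have "card S \<le> (\<Sum>B\<in>\<B>. card (net B))" unfolding S_def using fin by (rule card_UN_le)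
    then have "real (card S) \<le> (\<Sum>B\<in>\<B>. real (card (net B)))"
      by (metis of_nat_le_iff of_nat_sum)
    also have "\<dots> \<le> (\<Sum>B\<in>\<B>. m)" using net by (intro sum_mono) auto
    finally have card: "real (card S) \<le> real (card \<B>) * m" by simp
    have "T \<subseteq> (\<Union>x\<in>S. {x - K * r..x + K * r})"
    proof
      fix t assume t: "t \<in> T"
      then obtain B where "B \<in> \<B>" "v 0 t \<in> B" using cover unfolding box_cover_def by blast
      with t net[of B] show "t \<in> (\<Union>x\<in>S. {x - K * r..x + K * r})" unfolding S_def E_def by blast
    qed
    moreover have "finite S" "S \<subseteq> T" using fin net unfolding S_def E_def by auto
    ultimately have "1 \<le> A * (real (card S) * (K * r) powr s)" using A(2)[OF Kr] by blast
    also have "\<dots> \<le> A * (real (card \<B>) * m * (K * r) powr s)"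
      using A(1) card by (intro mult_left_mono mult_right_mono) auto
    also have "(K * r) powr s = K powr s * r powr s" using K r by (simp add: powr_mult)
    finally show "r powr (- s) \<le> (A * m * K powr s) * real (card \<B>)"
      using r by (simp add: powr_minus field_simps)
  qed
qed

end

section \<open>Growth of the covering number\<close>

text \<open>In the coordinates \<open>x $ i = - ln (\<delta> $ i)\<close> this is \<open>- ln r\<close>, where \<open>r\<close> is the minimum of
  \<open>\<delta> $ i powr (1 / pos i)\<close>. A time of order \<open>r\<close> is the longest that a nondegenerate curve can spend in a box
  of sides \<open>\<delta>\<close> without leaving it.\<close>

definition max_slope :: "real ^ 'n::{finite,linorder} \<Rightarrow> real" where
  "max_slope x = Max (range (\<lambda>i. x $ i / real (pos i)))"

lemma pos_pos: "0 < real (pos i)"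
  using pos_ge_1[of i] by simp

lemma le_max_slope: "x $ i \<le> real (pos i) * max_slope x"
proof -
  have "x $ i / real (pos i) \<le> max_slope x" unfolding max_slope_def by (rule Max_ge) auto
  then show ?thesis using pos_pos[of i] by (simp add: field_simps)
qed

lemma max_slope_attained:
  obtains k where "x $ k = real (pos k) * max_slope x"
proof -
  have "max_slope x \<in> range (\<lambda>i. x $ i / real (pos i))"
    unfolding max_slope_def by (rule Max_in) auto
  then obtain k where "max_slope x = x $ k / real (pos k)" by blast
  then show thesis using that[of k] pos_pos[of k] by simp
qed

text \<open>The constant is uniform over the whole cone, which is what turns statements on limits over all
  scales into statements on the exponents alone.\<close>

definition two_sided_growth :: "real \<Rightarrow> (real ^ 'n::{finite,linorder}) set \<Rightarrow> real \<Rightarrow> bool" where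
  "two_sided_growth s F A \<longleftrightarrow> 1 \<le> A \<and> (\<forall>x\<in>Cone.
     inverse A * exp (s * max_slope x) \<le> real (covering_number F (exp_scale 1 x)) \<and>
     real (covering_number F (exp_scale 1 x)) \<le> A * exp (s * max_slope x))"

text \<open>With \<open>r = exp (- max_slope x)\<close> the sides of \<open>exp_scale 1 x\<close> satisfy \<open>r ^ pos i \<le> \<delta> $ i\<close> for all \<open>i\<close>, with
  equality for some \<open>i\<close>. The inequalities give the cover, and the equality gives the lower bound.\<close>

lemma (in nondegenerate_curve) covering_number_growth:
  assumes T: "ahlfors_regular s T" "T \<subseteq> I"
  obtains A where "two_sided_growth s (v 0 ` T) A"
proof -
  obtain c where c: "0 < c" "c \<le> 1" and
    cover: "\<And>S r \<delta>. finite S \<Longrightarrow> S \<subseteq> I \<Longrightarrow> T \<subseteq> (\<Union>x\<in>S. {x - c * r..x + c * r}) \<Longrightarrow> 0 < r \<Longrightarrow>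
      \<forall>i. r ^ pos i \<le> \<delta> $ i \<Longrightarrow> \<forall>i j. i \<le> j \<longrightarrow> \<delta> $ j \<le> \<delta> $ i \<Longrightarrow>
      \<exists>\<B>. box_cover (v 0 ` T) \<delta> \<B> \<and> card \<B> \<le> card S"
  proof (rule box_cover_of_net[OF T(2)])
    fix c assume *: "0 < c" "c \<le> 1" "\<And>S r \<delta>. finite S \<Longrightarrow> S \<subseteq> I \<Longrightarrow> T \<subseteq> (\<Union>x\<in>S. {x - c * r..x + c * r}) \<Longrightarrow> 0 < r \<Longrightarrow>
      \<forall>i. r ^ pos i \<le> \<delta> $ i \<Longrightarrow> \<forall>i j. i \<le> j \<longrightarrow> \<delta> $ j \<le> \<delta> $ i \<Longrightarrow>
      \<exists>\<B>. box_cover (v 0 ` T) \<delta> \<B> \<and> card \<B> \<le> card S"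
    show thesis by (rule that[OF *])
  qed
  obtain A1 where A1: "0 < A1"
    "\<And>d S. 0 < d \<Longrightarrow> d \<le> 1 \<Longrightarrow> finite S \<Longrightarrow> S \<subseteq> T \<Longrightarrow> separated d S \<Longrightarrow> real (card S) \<le> A1 * d powr (- s)"
    using ahlfors_separated_card_le[OF T(1)] by blast
  obtain A2 where A2: "\<And>r \<delta> k \<B>. 0 < r \<Longrightarrow> r \<le> 1 \<Longrightarrow> \<delta> $ k \<le> r ^ pos k \<Longrightarrow> box_cover (v 0 ` T) \<delta> \<B> \<Longrightarrow>
    r powr (- s) \<le> A2 * real (card \<B>)"
    using box_cover_card_ge[OF T] by blast
  define A where "A = Max {1, A1 * c powr (- s), A2}"
  have A: "1 \<le> A" "A1 * c powr (- s) \<le> A" "A2 \<le> A" by (auto simp: A_def)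
  show thesis
  proof (rule that[of A], unfold two_sided_growth_def, intro conjI ballI A(1))
    fix x :: "(real, 'n) vec" assume x: "x \<in> Cone"
    define r where "r = exp (- max_slope x)"
    define \<delta> where "\<delta> = exp_scale 1 x"
    have "0 < x $ first" using x by (simp add: Cone_def)
    then have slope: "0 < max_slope x" using le_max_slope[of x first] by (simp add: pos_first)
    have r: "0 < r" "r \<le> 1" using slope by (auto simp: r_def)
    have rp: "r ^ pos i = exp (- (real (pos i) * max_slope x))" for i
      by (simp add: r_def exp_of_nat_mult[symmetric])
    have rs: "r powr (- s) = exp (s * max_slope x)"
      by (simp add: r_def powr_def)
    have \<delta>: "r ^ pos i \<le> \<delta> $ i" for i
      using le_max_slope[of x i] by (simp add: rp \<delta>_def exp_scale_def)
    have mono: "\<delta> $ j \<le> \<delta> $ i" if "i \<le> j" for i j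
      using x that by (simp add: Cone_def \<delta>_def exp_scale_def)
    obtain k where "x $ k = real (pos k) * max_slope x" by (rule max_slope_attained)
    then have k: "\<delta> $ k \<le> r ^ pos k" by (simp add: rp \<delta>_def exp_scale_def)
    have cr: "0 < c * r" "c * r \<le> 1" using c r by (auto simp: mult_le_one)
    obtain S where S: "finite S" "S \<subseteq> T" "real (card S) \<le> A1 * (c * r) powr (- s)"
      "T \<subseteq> (\<Union>x\<in>S. {x - c * r..x + c * r})"
      using maximal_separated_net[OF cr(1), of T, OF A1(2)[OF cr]] by blast
    obtain \<B> where \<B>: "box_cover (v 0 ` T) \<delta> \<B>" "card \<B> \<le> card S"
      using cover[OF S(1) _ S(4) r(1), of \<delta>] S(2) T(2) \<delta> mono by blast
    have "real (covering_number (v 0 ` T) \<delta>) \<le> real (card S)"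
      using covering_number_le[OF \<B>(1)] \<B>(2) by linarith
    also have "\<dots> \<le> A1 * c powr (- s) * r powr (- s)"
      using S(3) c r by (simp add: powr_mult mult.assoc)
    also have "\<dots> \<le> A * r powr (- s)" using A(2) by (intro mult_right_mono) auto
    finally show "real (covering_number (v 0 ` T) (exp_scale 1 x)) \<le> A * exp (s * max_slope x)"
      by (simp add: rs \<delta>_def)
    obtain \<C> where \<C>: "box_cover (v 0 ` T) \<delta> \<C>" "card \<C> = covering_number (v 0 ` T) \<delta>"
      using covering_number_attained[OF \<B>(1)] by blast
    have "r powr (- s) \<le> A2 * real (card \<C>)" using A2[OF r k \<C>(1)] .
    also have "\<dots> \<le> A * real (card \<C>)" using A(3) by (intro mult_right_mono) auto
    finally show "inverse A * exp (s * max_slope x) \<le> real (covering_number (v 0 ` T) (exp_scale 1 x))"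
      using A(1) \<C>(2) by (simp add: rs \<delta>_def field_simps)
  qed
qed

section \<open>Profiles and prints from two-sided growth\<close>

lemma max_slope_eqI:
  assumes "\<And>i. x $ i \<le> real (pos i) * m" "x $ k = real (pos k) * m"
  shows "max_slope x = m"
proof (rule antisym)
  obtain j where "x $ j = real (pos j) * max_slope x" by (rule max_slope_attained)
  then have "real (pos j) * max_slope x \<le> real (pos j) * m" using assms(1)[of j] by simp
  then show "max_slope x \<le> m" using pos_pos[of j] by simp
  have "real (pos k) * m \<le> real (pos k) * max_slope x" using assms(2) le_max_slope[of x k] by simp
  then show "m \<le> max_slope x" using pos_pos[of k] by simp
qed

lemma max_slope_scaleR:
  assumes "0 < t"
  shows "max_slope (t *\<^sub>R x) = t * max_slope x"
proof -
  obtain k where "x $ k = real (pos k) * max_slope x" by (rule max_slope_attained)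
  with assms le_max_slope[of x] show ?thesis
    by (intro max_slope_eqI[of _ _ k]) (auto simp: mult.left_commute)
qed

lemma Cone_scaleR: "0 < t \<Longrightarrow> x \<in> Cone \<Longrightarrow> t *\<^sub>R x \<in> Cone"
  by (auto simp: Cone_def)

lemma exp_scale_scaleR: "exp_scale t a = exp_scale 1 (t *\<^sub>R a)"
  by (simp add: exp_scale_def)

lemma Scales_eq_exp_scale_Cone: "Scales = exp_scale 1 ` Cone"
proof (intro set_eqI iffI)
  fix \<delta> :: "real ^ 'n::{finite,linorder}"
  assume \<delta>: "\<delta> \<in> Scales"
  define x where "x = (\<chi> i. - ln (\<delta> $ i))"
  have "x \<in> Cone" using \<delta> by (auto simp: Scales_def Cone_def x_def)
  moreover have "\<delta> = exp_scale 1 x"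
    using \<delta> by (simp add: Scales_def exp_scale_def x_def vec_eq_iff)
  ultimately show "\<delta> \<in> exp_scale 1 ` Cone" by blast
next
  fix \<delta> :: "real ^ 'n::{finite,linorder}"
  assume "\<delta> \<in> exp_scale 1 ` Cone"
  then show "\<delta> \<in> Scales" by (auto simp: Scales_def exp_scale_def Cone_def)
qed

lemma eventually_scales_to_0:
  "eventually P scales_to_0 \<longleftrightarrow> (\<exists>X. \<forall>x\<in>Cone. X < x $ first \<longrightarrow> P (exp_scale 1 x))"
proof
  assume "eventually P scales_to_0"
  then obtain b where b: "0 < b" "\<And>\<delta>. \<delta> \<in> Scales \<Longrightarrow> 0 < \<delta> $ first \<Longrightarrow> \<delta> $ first < b \<Longrightarrow> P \<delta>"
    unfolding scales_to_0_def eventually_inf_principal eventually_filtercomap eventually_at_right_field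
    by metis
  show "\<exists>X. \<forall>x\<in>Cone. X < x $ first \<longrightarrow> P (exp_scale 1 x)"
  proof (intro exI ballI impI)
    fix x :: "(real, 'a) vec" assume x: "x \<in> Cone" "- ln b < x $ first"
    have "exp (- x $ first) < exp (ln b)" using x(2) by simp
    then have "exp_scale 1 x $ first < b" "0 < exp_scale 1 x $ first"
      using b(1) by (auto simp: exp_scale_def)
    moreover have "exp_scale 1 x \<in> Scales"
      using x(1) unfolding Scales_eq_exp_scale_Cone by blast
    ultimately show "P (exp_scale 1 x)" by (intro b(2))
  qed
next
  assume "\<exists>X. \<forall>x\<in>Cone. X < x $ first \<longrightarrow> P (exp_scale 1 x)"
  then obtain X where X: "\<And>x. x \<in> Cone \<Longrightarrow> X < x $ first \<Longrightarrow> P (exp_scale 1 x)" by blast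
  have "P \<delta>" if \<delta>: "\<delta> \<in> Scales" "\<delta> $ first < exp (- X)" for \<delta>
  proof -
    obtain x where x: "x \<in> Cone" "\<delta> = exp_scale 1 x" using \<delta>(1) unfolding Scales_eq_exp_scale_Cone by blast
    then show ?thesis using X[OF x(1)] \<delta>(2) by (simp add: exp_scale_def)
  qed
  then have "\<forall>\<delta>. \<delta> $ first < exp (- X) \<longrightarrow> \<delta> \<in> Scales \<longrightarrow> P \<delta>" by blast
  moreover have "eventually (\<lambda>y. y < exp (- X)) (at_right 0)"
    unfolding eventually_at_right_field by (intro exI[of _ "exp (- X)"]) auto
  ultimately show "eventually P scales_to_0"
    unfolding scales_to_0_def eventually_inf_principal eventually_filtercomap by blast
qed

lemma monomial_exp_scale: "monomial (exp_scale 1 x) \<alpha> = exp (- (\<Sum>i\<in>UNIV. \<alpha> $ i * x $ i))"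
  by (simp add: monomial_def exp_scale_def powr_def exp_sum[symmetric] sum_negf)

text \<open>The logarithm, up to a bounded error, of the quantity whose lower and upper limits define the
  prints.\<close>

definition print_exponent :: "real \<Rightarrow> real ^ 'n::{finite,linorder} \<Rightarrow> real ^ 'n::{finite,linorder} \<Rightarrow> real" where
  "print_exponent s \<alpha> x = s * max_slope x - (\<Sum>i\<in>UNIV. \<alpha> $ i * x $ i)"

lemma two_sided_growth_monomial:
  assumes "two_sided_growth s F A" "x \<in> Cone"
  shows "inverse A * exp (print_exponent s \<alpha> x) \<le> real (covering_number F (exp_scale 1 x)) * monomial (exp_scale 1 x) \<alpha>"
    and "real (covering_number F (exp_scale 1 x)) * monomial (exp_scale 1 x) \<alpha> \<le> A * exp (print_exponent s \<alpha> x)"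
proof -
  let ?N = "real (covering_number F (exp_scale 1 x))" and ?\<sigma> = "\<Sum>i\<in>UNIV. \<alpha> $ i * x $ i"
  have N: "inverse A * exp (s * max_slope x) \<le> ?N" "?N \<le> A * exp (s * max_slope x)"
    using assms by (auto simp: two_sided_growth_def)
  have split: "exp (print_exponent s \<alpha> x) = exp (s * max_slope x) * exp (- ?\<sigma>)"
    by (simp add: print_exponent_def exp_diff exp_minus field_simps)
  show "inverse A * exp (print_exponent s \<alpha> x) \<le> ?N * monomial (exp_scale 1 x) \<alpha>"
    using mult_right_mono[OF N(1), of "exp (- ?\<sigma>)"] unfolding monomial_exp_scale split by (simp add: mult.assoc)
  show "?N * monomial (exp_scale 1 x) \<alpha> \<le> A * exp (print_exponent s \<alpha> x)"
    using mult_right_mono[OF N(2), of "exp (- ?\<sigma>)"] unfolding monomial_exp_scale split by (simp add: mult.assoc)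
qed

lemma lower_print_iff:
  assumes growth: "two_sided_growth s F A"
  shows "\<alpha> \<in> lower_print F \<longleftrightarrow> (\<forall>i. 0 \<le> \<alpha> $ i) \<and>
    (\<exists>b X. \<forall>x\<in>Cone. X < x $ first \<longrightarrow> b \<le> print_exponent s \<alpha> x)"
proof -
  let ?f = "\<lambda>\<delta>. real (covering_number F \<delta>) * monomial \<delta> \<alpha>"
  have A: "1 \<le> A" using growth by (simp add: two_sided_growth_def)
  note bounds = two_sided_growth_monomial[OF growth, of _ \<alpha>]
  have "0 < Liminf scales_to_0 (\<lambda>\<delta>. ereal (?f \<delta>)) \<longleftrightarrow>
    (\<exists>b X. \<forall>x\<in>Cone. X < x $ first \<longrightarrow> b \<le> print_exponent s \<alpha> x)" (is "?L \<longleftrightarrow> ?R")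
  proof
    assume ?L
    then obtain e where e: "0 < e" "ereal e < Liminf scales_to_0 (\<lambda>\<delta>. ereal (?f \<delta>))"
      using ereal_dense2[of 0] by (auto simp: zero_ereal_def)
    then have "eventually (\<lambda>\<delta>. ereal e < ereal (?f \<delta>)) scales_to_0"
      by (intro less_LiminfD)
    then obtain X where X: "\<And>x. x \<in> Cone \<Longrightarrow> X < x $ first \<Longrightarrow> e < ?f (exp_scale 1 x)"
      unfolding eventually_scales_to_0 by auto
    show ?R
    proof (intro exI ballI impI)
      fix x :: "(real, 'a) vec" assume x: "x \<in> Cone" "X < x $ first"
      then have "e < A * exp (print_exponent s \<alpha> x)" using X[OF x] bounds(2)[OF x(1)] by linarith
      then have "exp (ln (e / A)) \<le> exp (print_exponent s \<alpha> x)"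
        using A e(1) by (simp add: field_simps)
      then show "ln (e / A) \<le> print_exponent s \<alpha> x" by (simp only: exp_le_cancel_iff)
    qed
  next
    assume ?R
    then obtain b X where X: "\<And>x. x \<in> Cone \<Longrightarrow> X < x $ first \<Longrightarrow> b \<le> print_exponent s \<alpha> x" by blast
    have "inverse A * exp b \<le> ?f (exp_scale 1 x)" if "x \<in> Cone" "X < x $ first" for x
    proof -
      have "inverse A * exp b \<le> inverse A * exp (print_exponent s \<alpha> x)"
        using A X[OF that] by (intro mult_left_mono) auto
      with bounds(1)[OF that(1)] show ?thesis by linarith
    qed
    then have "eventually (\<lambda>\<delta>. ereal (inverse A * exp b) \<le> ereal (?f \<delta>)) scales_to_0"
      unfolding eventually_scales_to_0 by auto
    then have "ereal (inverse A * exp b) \<le> Liminf scales_to_0 (\<lambda>\<delta>. ereal (?f \<delta>))"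
      by (rule Liminf_bounded)
    moreover have "0 < ereal (inverse A * exp b)" using A by simp
    ultimately show ?L by (rule less_le_trans[rotated])
  qed
  then show ?thesis by (simp add: lower_print_def)
qed

lemma upper_print_iff:
  assumes growth: "two_sided_growth s F A"
  shows "\<alpha> \<in> upper_print F \<longleftrightarrow> (\<forall>i. 0 \<le> \<alpha> $ i) \<and>
    (\<exists>b. \<forall>X. \<exists>x\<in>Cone. X < x $ first \<and> b \<le> print_exponent s \<alpha> x)"
proof -
  let ?f = "\<lambda>\<delta>. real (covering_number F \<delta>) * monomial \<delta> \<alpha>"
  have A: "1 \<le> A" using growth by (simp add: two_sided_growth_def)
  note bounds = two_sided_growth_monomial[OF growth, of _ \<alpha>]
  have "\<not> 0 < Limsup scales_to_0 (\<lambda>\<delta>. ereal (?f \<delta>)) \<longleftrightarrow>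
    (\<forall>b. \<exists>X. \<forall>x\<in>Cone. X < x $ first \<longrightarrow> print_exponent s \<alpha> x < b)" (is "\<not> ?L \<longleftrightarrow> ?R")
  proof
    assume "\<not> ?L"
    then have le: "Limsup scales_to_0 (\<lambda>\<delta>. ereal (?f \<delta>)) \<le> 0" by simp
    show ?R
    proof
      fix b
      have "eventually (\<lambda>\<delta>. ereal (?f \<delta>) < ereal (inverse A * exp b)) scales_to_0"
        using le[unfolded Limsup_le_iff, rule_format, of "ereal (inverse A * exp b)"] A by simp
      then obtain X where X: "\<And>x. x \<in> Cone \<Longrightarrow> X < x $ first \<Longrightarrow> ?f (exp_scale 1 x) < inverse A * exp b"
        unfolding eventually_scales_to_0 by auto
      show "\<exists>X. \<forall>x\<in>Cone. X < x $ first \<longrightarrow> print_exponent s \<alpha> x < b"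
      proof (intro exI ballI impI)
        fix x :: "(real, 'a) vec" assume x: "x \<in> Cone" "X < x $ first"
        have "inverse A * exp (print_exponent s \<alpha> x) < inverse A * exp b"
          using X[OF x] bounds(1)[OF x(1)] by linarith
        then show "print_exponent s \<alpha> x < b" using A by simp
      qed
    qed
  next
    assume R: ?R
    have "Limsup scales_to_0 (\<lambda>\<delta>. ereal (?f \<delta>)) \<le> 0"
      unfolding Limsup_le_iff
    proof (intro allI impI)
      fix y :: ereal assume "0 < y"
      then obtain e where e: "0 < e" "ereal e < y"
        using ereal_dense2[of 0 y] by (auto simp: zero_ereal_def)
      obtain X where X: "\<And>x. x \<in> Cone \<Longrightarrow> X < x $ first \<Longrightarrow> print_exponent s \<alpha> x < ln (e / A)"
        using R by blast
      have "ereal (?f (exp_scale 1 x)) < y" if x: "x \<in> Cone" "X < x $ first" for x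
      proof -
        have "exp (print_exponent s \<alpha> x) < exp (ln (e / A))" using X[OF x] by simp
        then have "A * exp (print_exponent s \<alpha> x) < e" using A e(1) by (simp add: field_simps)
        then have "ereal (?f (exp_scale 1 x)) < ereal e" using bounds(2)[OF x(1)] by simp
        with e(2) show ?thesis by (rule less_trans[rotated])
      qed
      then show "eventually (\<lambda>\<delta>. ereal (?f \<delta>) < y) scales_to_0"
        unfolding eventually_scales_to_0 by blast
    qed
    then show "\<not> ?L" by simp
  qed
  then have "?L \<longleftrightarrow> (\<exists>b. \<forall>X. \<exists>x\<in>Cone. X < x $ first \<and> b \<le> print_exponent s \<alpha> x)"
    by (meson not_le)
  then show ?thesis by (simp add: upper_print_def)
qed

lemma two_sided_growth_log_growth:
  assumes growth: "two_sided_growth s F A" and a: "a \<in> Cone"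
  shows "(log_growth F a \<longlongrightarrow> s * max_slope a) at_top"
proof -
  have A: "1 \<le> A" using growth by (simp add: two_sided_growth_def)
  have "norm (log_growth F a t - s * max_slope a) \<le> ln A / t" if t: "0 < t" for t
  proof -
    let ?N = "real (covering_number F (exp_scale t a))"
    have N: "inverse A * exp (t * (s * max_slope a)) \<le> ?N" "?N \<le> A * exp (t * (s * max_slope a))"
      using growth Cone_scaleR[OF t a] t unfolding two_sided_growth_def exp_scale_scaleR[of t a]
      by (auto simp: max_slope_scaleR mult.left_commute)
    have pos: "0 < inverse A * exp (t * (s * max_slope a))" using A by simp
    then have "ln (inverse A * exp (t * (s * max_slope a))) \<le> ln ?N" "ln ?N \<le> ln (A * exp (t * (s * max_slope a)))"
      using N by (auto intro: ln_mono)
    then have "\<bar>ln ?N - t * (s * max_slope a)\<bar> \<le> ln A"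
      using A by (simp add: ln_mult ln_inverse abs_le_iff)
    moreover have "log_growth F a t - s * max_slope a = (ln ?N - t * (s * max_slope a)) / t"
      using t by (simp add: log_growth_def field_simps)
    ultimately show ?thesis using t by (simp add: divide_right_mono)
  qed
  then have "eventually (\<lambda>t. norm (log_growth F a t - s * max_slope a) \<le> ln A / t) at_top"
    using eventually_gt_at_top[of 0] by (rule eventually_mono[rotated])
  moreover have "((\<lambda>t. ln A / t) \<longlongrightarrow> 0) at_top"
    by (intro tendsto_divide_0[OF tendsto_const] filterlim_at_top_imp_at_infinity filterlim_ident)
  ultimately have "((\<lambda>t. log_growth F a t - s * max_slope a) \<longlongrightarrow> 0) at_top"
    by (rule Lim_null_comparison)
  then show ?thesis by (simp add: LIM_zero_iff)
qed

lemma two_sided_growth_profile: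
  assumes "two_sided_growth s F A" "a \<in> Cone"
  shows "profile F a = s * max_slope a"
  unfolding profile_def using two_sided_growth_log_growth[OF assms] by (intro tendsto_Lim) auto

lemma two_sided_growth_uniformly_profile_regular:
  assumes growth: "two_sided_growth s F A"
  shows "uniformly_profile_regular F"
  unfolding uniformly_profile_regular_def profile_exists_def
proof (intro conjI)
  show "\<forall>a\<in>Cone. \<exists>L. (log_growth F a \<longlongrightarrow> L) at_top"
    using two_sided_growth_log_growth[OF growth] by blast
  have "inverse A * exp (t * profile F a) \<le> real (covering_number F (exp_scale t a)) \<and>
      real (covering_number F (exp_scale t a)) \<le> A * exp (t * profile F a)"
    if "a \<in> Normalized_Cone" "1 \<le> t" for a t
  proof -
    have a: "a \<in> Cone" using that(1) by (simp add: Normalized_Cone_def)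
    show ?thesis
      using growth Cone_scaleR[OF _ a, of t] that(2)
      unfolding two_sided_growth_def exp_scale_scaleR[of t a] two_sided_growth_profile[OF growth a]
      by (auto simp: max_slope_scaleR mult.left_commute)
  qed
  moreover have "1 \<le> A" using growth by (simp add: two_sided_growth_def)
  ultimately show "\<exists>C t0. 1 \<le> C \<and> 0 < t0 \<and> (\<forall>a\<in>Normalized_Cone. \<forall>t\<ge>t0.
      inverse C * exp (t * profile F a) \<le> real (covering_number F (exp_scale t a)) \<and>
      real (covering_number F (exp_scale t a)) \<le> C * exp (t * profile F a))"
    by (intro exI[of _ A] exI[of _ 1]) auto
qed

text \<open>The exponent is non-negative on the cone if \<open>\<Sum>i. pos i * \<alpha> $ i \<le> s\<close>, because
  \<open>x $ i \<le> pos i * max_slope x\<close>. Equality for all \<open>i\<close> holds on the ray \<open>x $ i = t * pos i\<close>, and along it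
  the exponent tends to \<open>- \<infinity>\<close> otherwise.\<close>

lemma two_sided_growth_lower_print:
  assumes growth: "two_sided_growth s F A"
  shows "lower_print F = {\<alpha>. (\<forall>i. 0 \<le> \<alpha> $ i) \<and> (\<Sum>i\<in>UNIV. real (pos i) * \<alpha> $ i) \<le> s}"
proof (rule set_eqI, unfold mem_Collect_eq lower_print_iff[OF growth], rule conj_cong[OF refl])
  fix \<alpha> :: "real ^ 'n::{finite,linorder}"
  assume \<alpha>: "\<forall>i. 0 \<le> \<alpha> $ i"
  let ?w = "\<Sum>i\<in>UNIV. real (pos i) * \<alpha> $ i"
  show "(\<exists>b X. \<forall>x\<in>Cone. X < x $ first \<longrightarrow> b \<le> print_exponent s \<alpha> x) \<longleftrightarrow> ?w \<le> s"
  proof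
    assume "?w \<le> s"
    have "0 \<le> print_exponent s \<alpha> x" if "x \<in> Cone" for x
    proof -
      have "0 < x $ first" using that by (simp add: Cone_def)
      then have m: "0 < max_slope x" using le_max_slope[of x first] by (simp add: pos_first)
      have "(\<Sum>i\<in>UNIV. \<alpha> $ i * x $ i) \<le> (\<Sum>i\<in>UNIV. \<alpha> $ i * (real (pos i) * max_slope x))"
        using \<alpha> le_max_slope by (intro sum_mono mult_left_mono) auto
      also have "\<dots> = ?w * max_slope x" unfolding sum_distrib_right by (simp add: mult_ac)
      also have "\<dots> \<le> s * max_slope x" using \<open>?w \<le> s\<close> m by (intro mult_right_mono) auto
      finally show ?thesis by (simp add: print_exponent_def)
    qed
    then show "\<exists>b X. \<forall>x\<in>Cone. X < x $ first \<longrightarrow> b \<le> print_exponent s \<alpha> x" by blast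
  next
    assume "\<exists>b X. \<forall>x\<in>Cone. X < x $ first \<longrightarrow> b \<le> print_exponent s \<alpha> x"
    then obtain b X where X: "\<And>x. x \<in> Cone \<Longrightarrow> X < x $ first \<Longrightarrow> b \<le> print_exponent s \<alpha> x" by blast
    show "?w \<le> s"
    proof (rule ccontr)
      assume "\<not> ?w \<le> s"
      then have gap: "0 < ?w - s" by simp
      define t where "t = max 1 (max (X + 1) ((1 - b) / (?w - s)))"
      have t: "0 < t" "X < t" "(1 - b) / (?w - s) \<le> t" by (auto simp: t_def)
      define x :: "(real, 'n) vec" where "x = (\<chi> i. t * real (pos i))"
      have "x \<in> Cone" using t(1) by (auto simp: Cone_def x_def pos_le_iff intro!: mult_pos_pos pos_pos)
      moreover have "x $ first = t" by (simp add: x_def pos_first)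
      ultimately have "b \<le> print_exponent s \<alpha> x" using X t(2) by simp
      moreover have "max_slope x = t" by (rule max_slope_eqI[of _ _ first]) (auto simp: x_def)
      then have "print_exponent s \<alpha> x = - (t * (?w - s))"
        by (simp add: print_exponent_def x_def sum_distrib_left algebra_simps)
      moreover have "1 - b \<le> t * (?w - s)" using t(3) gap by (simp add: field_simps)
      ultimately show False by simp
    qed
  qed
qed

lemma tail_sum_1: "tail_sum 1 \<alpha> = (\<Sum>i\<in>UNIV. \<alpha> $ i)"
  unfolding tail_sum_def using pos_ge_1 by (intro sum.cong) auto

text \<open>Let the coordinates before \<open>k\<close> stay at \<open>t\<close> and the others equal a much larger \<open>y\<close>. The maximal slope
  is then at least \<open>y / k\<close>, so the exponent is at least \<open>y * (s / k - tail_sum k \<alpha>)\<close> up to a multiple of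
  \<open>t\<close>.\<close>

lemma upper_print_sufficient:
  assumes s: "0 < s" and \<alpha>: "\<forall>i. 0 \<le> \<alpha> $ i"
    and k: "2 \<le> k" "k \<le> CARD('n)" "tail_sum k \<alpha> < s / real k"
  shows "\<exists>x\<in>Cone. X < x $ first \<and> 0 \<le> print_exponent s (\<alpha> :: real ^ 'n::{finite,linorder}) x"
proof -
  obtain \<kappa> :: 'n where \<kappa>: "pos \<kappa> = k" using pos_surj[of k] k by auto
  define gap where "gap = s / real k - tail_sum k \<alpha>"
  have gap: "0 < gap" using k(3) by (simp add: gap_def)
  define t where "t = max 1 (X + 1)"
  define y where "y = max t (t * tail_sum 1 \<alpha> / gap)"
  have ty: "0 < t" "X < t" "t \<le> y" "t * tail_sum 1 \<alpha> \<le> y * gap"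
    using gap by (auto simp: t_def y_def field_simps max_def)
  define x :: "(real, 'n) vec" where "x = (\<chi> i. if pos i < k then t else y)"
  have "x \<in> Cone"
  proof -
    have "x $ i \<le> x $ j" if "i \<le> j" for i j
      using ty(3) that pos_le_iff[of i j] by (auto simp: x_def)
    moreover have "0 < x $ i" for i using ty(1,3) by (auto simp: x_def)
    ultimately show ?thesis by (simp add: Cone_def)
  qed
  moreover have "X < x $ first" using ty k by (simp add: x_def pos_first)
  moreover have "0 \<le> print_exponent s \<alpha> x"
  proof -
    have "y \<le> real k * max_slope x" using le_max_slope[of x \<kappa>] by (simp add: x_def \<kappa>)
    then have "s * y \<le> s * (real k * max_slope x)" using s by (intro mult_left_mono) auto
    then have 1: "y * (s / real k) \<le> s * max_slope x" using k(1) by (simp add: field_simps)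
    have "(\<Sum>i\<in>UNIV. \<alpha> $ i * x $ i) \<le> (\<Sum>i\<in>UNIV. \<alpha> $ i * t + (if k \<le> pos i then \<alpha> $ i else 0) * y)"
      using \<alpha> ty by (intro sum_mono) (auto simp: x_def)
    also have "\<dots> = t * tail_sum 1 \<alpha> + y * tail_sum k \<alpha>"
      unfolding tail_sum_1 unfolding tail_sum_def sum.distrib sum_distrib_right[symmetric]
      by (simp add: sum.If_cases mult.commute)
    also have "\<dots> \<le> y * (s / real k)" using ty(4) by (simp add: gap_def algebra_simps)
    finally show ?thesis using 1 by (simp add: print_exponent_def)
  qed
  ultimately show ?thesis by blast
qed

text \<open>Let the maximal slope be attained at position \<open>k\<close>. By monotonicity of \<open>x\<close>, the sum of
  \<open>\<alpha> $ i * x $ i\<close> is at least \<open>x\<^sub>1 * tail_sum 1 \<alpha> + (x\<^sub>k - x\<^sub>1) * tail_sum k \<alpha>\<close>. The second term vanishes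
  for \<open>k = 1\<close>; otherwise inserting \<open>tail_sum k \<alpha> \<ge> s / k\<close> cancels \<open>s * max_slope x = s * x\<^sub>k / k\<close> and leaves
  \<open>x\<^sub>1 * (s / k - tail_sum 1 \<alpha>)\<close> as a bound in both cases.\<close>

lemma print_exponent_le:
  assumes s: "0 < s" and \<alpha>: "\<forall>i. 0 \<le> \<alpha> $ i" and x: "x \<in> Cone"
    and tails: "\<And>k. 2 \<le> k \<Longrightarrow> k \<le> CARD('n) \<Longrightarrow> s / real k \<le> tail_sum k (\<alpha> :: real ^ 'n::{finite,linorder})"
  shows "print_exponent s \<alpha> x \<le> x $ first * (s - tail_sum 1 \<alpha>)"
proof -
  obtain \<kappa> where \<kappa>: "x $ \<kappa> = real (pos \<kappa>) * max_slope x" by (rule max_slope_attained)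
  let ?k = "pos \<kappa>"
  have mono: "x $ i \<le> x $ j" if "i \<le> j" for i j using x that by (simp add: Cone_def)
  have first: "0 < x $ first" using x by (simp add: Cone_def)
  have "(\<Sum>i\<in>UNIV. \<alpha> $ i * x $ first + (if ?k \<le> pos i then \<alpha> $ i else 0) * (x $ \<kappa> - x $ first))
      \<le> (\<Sum>i\<in>UNIV. \<alpha> $ i * x $ i)"
  proof (rule sum_mono)
    fix i
    have "\<alpha> $ i * x $ first \<le> \<alpha> $ i * x $ i" using \<alpha> mono[OF first_le] by (intro mult_left_mono) auto
    moreover have "\<alpha> $ i * x $ \<kappa> \<le> \<alpha> $ i * x $ i" if "?k \<le> pos i"
      using \<alpha> mono that pos_le_iff[of \<kappa> i] by (intro mult_left_mono) auto
    ultimately show "\<alpha> $ i * x $ first + (if ?k \<le> pos i then \<alpha> $ i else 0) * (x $ \<kappa> - x $ first) \<le> \<alpha> $ i * x $ i"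
      by (auto simp: algebra_simps)
  qed
  also have "(\<Sum>i\<in>UNIV. \<alpha> $ i * x $ first + (if ?k \<le> pos i then \<alpha> $ i else 0) * (x $ \<kappa> - x $ first))
      = x $ first * tail_sum 1 \<alpha> + (x $ \<kappa> - x $ first) * tail_sum ?k \<alpha>"
    unfolding tail_sum_1 unfolding tail_sum_def sum.distrib sum_distrib_right[symmetric]
    by (simp add: sum.If_cases mult.commute)
  finally have 1: "x $ first * tail_sum 1 \<alpha> + (x $ \<kappa> - x $ first) * tail_sum ?k \<alpha> \<le> (\<Sum>i\<in>UNIV. \<alpha> $ i * x $ i)" .
  have 2: "(x $ \<kappa> - x $ first) * (s / real ?k) \<le> (x $ \<kappa> - x $ first) * tail_sum ?k \<alpha>"
  proof (cases "?k = 1")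
    case True
    then have "\<kappa> = first" using pos_first pos_eq_iff by metis
    then show ?thesis by simp
  next
    case False
    then have "s / real ?k \<le> tail_sum ?k \<alpha>"
      using tails[of ?k] pos_ge_1[of \<kappa>] pos_le_CARD[of \<kappa>] by simp
    then show ?thesis using mono[OF first_le, of \<kappa>] by (intro mult_left_mono) auto
  qed
  have 3: "x $ \<kappa> * (s / real ?k) = s * max_slope x" using \<kappa> pos_pos[of \<kappa>] by simp
  have "s / real ?k \<le> s" using s pos_ge_1[of \<kappa>] by (simp add: divide_le_eq)
  then have 4: "x $ first * (s / real ?k) \<le> x $ first * s" using first by (intro mult_left_mono) auto
  have "s * max_slope x - (\<Sum>i\<in>UNIV. \<alpha> $ i * x $ i) \<le> x $ first * s - x $ first * tail_sum 1 \<alpha>"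
    using 1 2[unfolded left_diff_distrib[of _ _ "s / real ?k"]] 3 4 by linarith
  then show ?thesis by (simp only: print_exponent_def right_diff_distrib)
qed

text \<open>If \<open>tail_sum 1 \<alpha> \<le> s\<close>, cubes witness membership: the exponent is non-negative on the diagonal. If
  neither this nor any of the strict inequalities holds, the exponent is at most
  \<open>- (tail_sum 1 \<alpha> - s) * x $ first\<close> and tends to \<open>- \<infinity>\<close> uniformly.\<close>

lemma two_sided_growth_upper_print:
  fixes F :: "(real ^ 'n::{finite,linorder}) set"
  assumes growth: "two_sided_growth s F A" and s: "0 < s"
  shows "upper_print F = {\<alpha>. (\<forall>i. 0 \<le> \<alpha> $ i) \<and> tail_sum 1 \<alpha> \<le> s} \<union>
      (\<Union>k\<in>{2..CARD('n)}. {\<alpha>. (\<forall>i. 0 \<le> \<alpha> $ i) \<and> tail_sum k \<alpha> < s / real k})" (is "_ = ?R")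
proof (rule set_eqI)
  fix \<alpha> :: "(real, 'n) vec"
  let ?Q = "\<exists>b. \<forall>X. \<exists>x\<in>Cone. X < x $ first \<and> b \<le> print_exponent s \<alpha> x"
  let ?tails = "tail_sum 1 \<alpha> \<le> s \<or> (\<exists>k\<in>{2..CARD('n)}. tail_sum k \<alpha> < s / real k)"
  have "?Q \<longleftrightarrow> ?tails" if \<alpha>: "\<forall>i. 0 \<le> \<alpha> $ i"
  proof
    assume ?tails
    have "\<exists>x\<in>Cone. X < x $ first \<and> 0 \<le> print_exponent s \<alpha> x" for X
    proof (cases "tail_sum 1 \<alpha> \<le> s")
      case True
      define t where "t = max 1 (X + 1)"
      have t: "0 < t" "X < t" by (auto simp: t_def)
      define x :: "(real, 'n) vec" where "x = (\<chi> i. t)"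
      have "t \<le> max_slope x" using le_max_slope[of x first] by (simp add: x_def pos_first)
      then have "s * t \<le> s * max_slope x" using s by (intro mult_left_mono) auto
      moreover have "(\<Sum>i\<in>UNIV. \<alpha> $ i * x $ i) = tail_sum 1 \<alpha> * t"
        unfolding tail_sum_1 by (simp add: x_def sum_distrib_right)
      moreover have "tail_sum 1 \<alpha> * t \<le> s * t" using True t by (intro mult_right_mono) auto
      ultimately have "0 \<le> print_exponent s \<alpha> x" by (simp add: print_exponent_def)
      moreover have "x \<in> Cone" "X < x $ first" using t by (auto simp: Cone_def x_def)
      ultimately show ?thesis by blast
    next
      case False
      with \<open>?tails\<close> obtain k where "2 \<le> k" "k \<le> CARD('n)" "tail_sum k \<alpha> < s / real k" by auto
      then show ?thesis using upper_print_sufficient[OF s \<alpha>] by blast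
    qed
    then show ?Q by blast
  next
    assume ?Q
    then obtain b where b: "\<And>X. \<exists>x\<in>Cone. X < x $ first \<and> b \<le> print_exponent s \<alpha> x" by blast
    show ?tails
    proof (rule ccontr)
      assume not: "\<not> ?tails"
      then have gap: "0 < tail_sum 1 \<alpha> - s" by simp
      obtain x where x: "x \<in> Cone" "(1 - b) / (tail_sum 1 \<alpha> - s) < x $ first" "b \<le> print_exponent s \<alpha> x"
        using b by blast
      have "print_exponent s \<alpha> x \<le> x $ first * (s - tail_sum 1 \<alpha>)"
        using not by (intro print_exponent_le[OF s \<alpha> x(1)]) (auto simp: not_less)
      moreover have "1 - b < x $ first * (tail_sum 1 \<alpha> - s)" using x(2) gap by (simp add: divide_less_eq)
      ultimately show False using x(3) by (simp add: right_diff_distrib)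
    qed
  qed
  then show "\<alpha> \<in> upper_print F \<longleftrightarrow> \<alpha> \<in> ?R"
    unfolding upper_print_iff[OF growth] by auto
qed

lemma nondegenerate_curve_of_regular_curve:
  fixes \<gamma> :: "real \<Rightarrow> real ^ 'n::{finite,linorder}"
  assumes "compact I" "is_interval I" "I \<subseteq> U"
    and smooth: "C_k_on (CARD('n) + 1) \<gamma> U"
    and det: "\<forall>t\<in>I. det (derivative_matrix \<gamma> t) \<noteq> 0"
  shows "nondegenerate_curve (\<lambda>j. iter_deriv j \<gamma>) I"
proof
  have diff: "iter_deriv j \<gamma> differentiable at t" if "j \<le> CARD('n)" "t \<in> I" for j t
    using smooth that assms(3) unfolding C_k_on_def by (auto simp: less_Suc_eq_le)
  show "(iter_deriv j \<gamma> has_vector_derivative iter_deriv (Suc j) \<gamma> t) (at t)"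
    if "j < CARD('n)" "t \<in> I" for j t
    using diff[of j t] that vector_derivative_works[of "iter_deriv j \<gamma>" "at t"] by (simp add: iter_deriv_def)
  show "continuous_on I (iter_deriv j \<gamma>)" if "j \<le> CARD('n)" for j
    using diff[OF that] by (intro continuous_at_imp_continuous_on ballI differentiable_imp_continuous_within)
  show "w = 0" if t: "t \<in> I" and orth: "\<And>i::'n. w \<bullet> iter_deriv (pos i) \<gamma> t = 0" for t w
  proof -
    let ?M = "derivative_matrix \<gamma> t"
    have "transpose ?M *v w = 0"
      using orth by (simp add: vec_eq_iff matrix_vector_mult_def transpose_def derivative_matrix_def inner_vec_def mult.commute)
    moreover have "invertible (transpose ?M)" using det t by (simp add: invertible_det_nz det_transpose)
    ultimately show "w = 0"
      using matrix_left_invertible_ker[of "transpose ?M"] unfolding invertible_left_inverse by blast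
  qed
qed (use assms in auto)

theorem theorem4p9:
  fixes U I T :: "real set"
    and \<gamma> :: "real \<Rightarrow> real ^ 'n::{finite,linorder}"
    and s :: real
  assumes "open U" and "is_interval U"
    and "compact I" and "is_interval I" and "I \<subseteq> U"
    and "C_k_embedding_on (CARD('n) + 1) \<gamma> U"
    and "\<forall>t\<in>I. det (derivative_matrix \<gamma> t) \<noteq> 0"
    and "0 < s" and "s \<le> 1"
    and "T \<subseteq> I" and "compact T" and "diameter T > 0" and "ahlfors_regular s T"
  shows "uniformly_profile_regular (\<gamma> ` T) \<and>
    (\<forall>a\<in>Cone. profile (\<gamma> ` T) a = s * Max (range (\<lambda>i. a $ i / real (pos i)))) \<and>
    lower_print (\<gamma> ` T) =
      {\<alpha>. (\<forall>i. 0 \<le> \<alpha> $ i) \<and> (\<Sum>i\<in>UNIV. real (pos i) * \<alpha> $ i) \<le> s} \<and>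
    upper_print (\<gamma> ` T) =
      {\<alpha>. (\<forall>i. 0 \<le> \<alpha> $ i) \<and> tail_sum 1 \<alpha> \<le> s} \<union>
      (\<Union>k\<in>{2..CARD('n)}. {\<alpha>. (\<forall>i. 0 \<le> \<alpha> $ i) \<and> tail_sum k \<alpha> < s / real k}) \<and>
    s = profile (\<gamma> ` T) (\<chi> i. 1)"
proof -
  have "C_k_on (CARD('n) + 1) \<gamma> U" using assms(6) by (simp add: C_k_embedding_on_def)
  then interpret nondegenerate_curve "\<lambda>j. iter_deriv j \<gamma>" I
    using assms(3-5,7) by (intro nondegenerate_curve_of_regular_curve)
  have "iter_deriv 0 \<gamma> = \<gamma>" by (simp add: iter_deriv_def)
  then obtain A where growth: "two_sided_growth s (\<gamma> ` T) A"
    using covering_number_growth[OF assms(13,10)] by metis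
  have ones: "(\<chi> i. 1) \<in> (Cone :: (real, 'n) vec set)" by (simp add: Cone_def)
  have "max_slope ((\<chi> i. 1) :: (real, 'n) vec) = 1"
    by (rule max_slope_eqI[of _ _ first]) (use pos_ge_1 in \<open>auto simp: pos_first\<close>)
  then have "s = profile (\<gamma> ` T) (\<chi> i. 1)"
    using two_sided_growth_profile[OF growth ones] by simp
  then show ?thesis
    using two_sided_growth_uniformly_profile_regular[OF growth] two_sided_growth_profile[OF growth]
      two_sided_growth_lower_print[OF growth] two_sided_growth_upper_print[OF growth assms(8)]
    by (simp add: max_slope_def)
qed

end
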